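(* For every integer $n \ge 2$ and every $2$-coloring of the edges of the hypercube $Q_n$, there exists an antipodal geodesic with at most $0.3125\, n + 6$ color changes.
   Context: The hypercube $Q_n$ has vertex set $\{0,1\}^n$, with an edge between two vertices iff they differ in exactly one coordinate. For $v$, its antipodal vertex $\bar v$ is obtained by complementing every coordinate. An antipodal geodesic is a path of length $n$ from some vertex $v$ to $\bar v$. The number of color changes of a path $P$ is the number of internal vertices of $P$ whose two incident edges on $P$ have different colors (equivalently, the least $k$ such that $P$ is a concatenation of $k+1$ monochromatic paths). *)

theory Defs
  imports Complex_Main
begin

definition cube_vertices :: "nat \<Rightarrow> bool list set" where
  "cube_vertices n = {v. length v = n}"

(* Edges are unordered pairs, so that a colouring assigns one colour to {u, v} = {v, u}. *)
definition cube_edges :: "nat \<Rightarrow> bool list set set" where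
  "cube_edges n =
    {{u, v} | u v. u \<in> cube_vertices n \<and> v \<in> cube_vertices n \<and> card {i. i < n \<and> u ! i \<noteq> v ! i} = 1}"

definition antipode :: "bool list \<Rightarrow> bool list" where
  "antipode v = map Not v"

(* A path is given by the list of its vertices; its length is length p - 1. *)
definition cube_path :: "nat \<Rightarrow> bool list list \<Rightarrow> bool" where
  "cube_path n p \<longleftrightarrow>
    p \<noteq> [] \<and> set p \<subseteq> cube_vertices n \<and> distinct p \<and>
    (\<forall>i. Suc i < length p \<longrightarrow> {p ! i, p ! Suc i} \<in> cube_edges n)"

definition antipodal_geodesic :: "nat \<Rightarrow> bool list list \<Rightarrow> bool" where
  "antipodal_geodesic n p \<longleftrightarrow>
    cube_path n p \<and> length p = n + 1 \<and> last p = antipode (hd p)"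

(* The internal vertices are p ! i with 0 < i < length p - 1; as the vertices of a path are
   distinct, counting the indices i is counting these vertices. The colouring c is a total function,
   but on a path of the n-cube only its values on cube_edges n are used. *)
definition color_changes :: "(bool list set \<Rightarrow> bool) \<Rightarrow> bool list list \<Rightarrow> nat" where
  "color_changes c p =
    card {i. 0 < i \<and> Suc i < length p \<and> c {p ! (i - 1), p ! i} \<noteq> c {p ! i, p ! Suc i}}"

end

theory Submission
  imports Defs "HOL-Combinatorics.Permutations"
begin

text \<open>
  Cut a random antipodal geodesic into blocks of four edges and reroute every block optimally within
  its four-dimensional subcube. In a four-dimensional cube the costs of the eight antipodal pairs,
  with half a change added for each pair whose optimal walks force the first colour, sum up to at most
  \<open>8 + b / 4\<close>, where \<open>b\<close> is the number of vertices with two edges of either colour; this is a finite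
  check, done by a SAT proof. As a random vertex is balanced in this sense on at most \<open>3/8\<close> of its
  quadruples of directions, up to \<open>O(1/n)\<close>, a block costs \<open>19/16\<close> on average. The half change pays for
  the junctions: blocks with a free first colour adapt to their predecessor, and at the junction of two
  other blocks the colours on both sides have (almost) the distribution of independent samples at the
  common vertex, so that they agree with probability at least \<open>1/2\<close>. This argument needs two
  sides of equal length, hence blocks are merged dyadically, up to eight of them. Such a chunk of 32
  edges together with its junction costs \<open>8 * 19/16 + 1/2 = 10 = 32 * 5/16\<close>.
\<close>

section \<open>Walks in a coloured cube\<close>

text \<open>A vertex is encoded as the set of its coordinates equal to 1. Symmetric difference with
  \<open>S\<close> then crosses every direction in \<open>S\<close> once, whatever the
  order.\<close>

definition flip :: "nat set \<Rightarrow> nat set \<Rightarrow> nat set" (infixl "\<oplus>" 65) where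
  "v \<oplus> S = {i. (i \<in> v) \<noteq> (i \<in> S)}"

lemma flip_assoc: "v \<oplus> S \<oplus> T = v \<oplus> (S \<oplus> T)"
  and flip_commute: "S \<oplus> T = T \<oplus> S"
  and flip_empty [simp]: "v \<oplus> {} = v"
  and flip_cancel [simp]: "v \<oplus> S \<oplus> S = v"
  by (auto simp: flip_def)

lemma flip_Un: "S \<inter> T = {} \<Longrightarrow> v \<oplus> (S \<union> T) = v \<oplus> S \<oplus> T"
  by (auto simp: flip_def)

lemma flip_insert: "i \<notin> set xs \<Longrightarrow> v \<oplus> insert i (set xs) = v \<oplus> {i} \<oplus> set xs"
  by (auto simp: flip_def)

lemma bij_betw_flip:
  assumes "A \<subseteq> I"
  shows "bij_betw (\<lambda>v. v \<oplus> A) (Pow I) (Pow I)"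
  by (rule bij_betw_byWitness[where f' = "\<lambda>v. v \<oplus> A"]) (use assms in \<open>auto simp: flip_def\<close>)

text \<open>\<open>Fixed a b k\<close> stands for a walk whose first and last edges have the colours \<open>a\<close> and \<open>b\<close> and
  that has \<open>k\<close> changes. \<open>Flexible t k\<close> stands for two such walks, one for each first colour; the
  last colour differs from the first one iff \<open>t\<close>. A flexible gadget can always be made to
  match its predecessor, so joining it costs nothing; this is the reason for the
  additional half change that \<open>weight\<close>, counted in half changes, charges for a fixed one.\<close>

datatype gadget = Fixed bool bool nat | Flexible bool nat

fun weight :: "gadget \<Rightarrow> nat" where
  "weight (Fixed a b k) = 2 * k + 1"
| "weight (Flexible t k) = 2 * k"

text \<open>The first colour as a sign, with 0 if it is free. The sign of the last colour is
  \<open>spin (reverse g)\<close>.\<close>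

fun spin :: "gadget \<Rightarrow> real" where
  "spin (Fixed a b k) = (if a then 1 else - 1)"
| "spin (Flexible t k) = 0"

fun reverse :: "gadget \<Rightarrow> gadget" where
  "reverse (Fixed a b k) = Fixed b a k"
| "reverse (Flexible t k) = Flexible t k"

fun join :: "gadget \<Rightarrow> gadget \<Rightarrow> gadget" where
  "join (Fixed a b k) (Fixed c d l) = Fixed a d (k + l + of_bool (b \<noteq> c))"
| "join (Fixed a b k) (Flexible t l) = Fixed a (b \<noteq> t) (k + l)"
| "join (Flexible t k) (Fixed a b l) = Fixed (a \<noteq> t) b (k + l)"
| "join (Flexible t k) (Flexible u l) = Flexible (t \<noteq> u) (k + l)"

lemma reverse_reverse [simp]: "reverse (reverse g) = g"
  by (cases g) auto

lemma weight_reverse [simp]: "weight (reverse g) = weight g"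
  by (cases g) auto

lemma reverse_join: "reverse (join g h) = join (reverse h) (reverse g)"
  by (cases g; cases h) auto

text \<open>Two fixed gadgets bring one extra half change each. Agreement at the junction saves one
  of them, a clash adds one, and a flexible partner changes nothing. So the mean of a product of
  spins decides what a random junction costs.\<close>

lemma weight_join: "real (weight (join g h)) = weight g + weight h - spin (reverse g) * spin h"
  by (cases g; cases h) auto

lemma spin_sq_le: "(spin g)\<^sup>2 \<le> 1"
  by (cases g) auto

lemma weight_join_le: "weight (join g h) \<le> weight g + weight h + 1"
  by (cases g; cases h) auto

section \<open>Walks, their costs and the gadgets they realise\<close>

locale cube_colouring =
  fixes col :: "nat set \<Rightarrow> nat \<Rightarrow> bool"
  assumes col_flip [simp]: "col (v \<oplus> {i}) i = col v i"
begin

text \<open>The colours \<open>a\<close> and \<open>b\<close> are those of the edges just before and just after the walk, so that the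
  cost is subadditive under concatenation.\<close>

primrec cost :: "nat set \<Rightarrow> bool \<Rightarrow> nat list \<Rightarrow> bool \<Rightarrow> nat" where
  "cost v a [] b = of_bool (a \<noteq> b)"
| "cost v a (i # xs) b = of_bool (a \<noteq> col v i) + cost (v \<oplus> {i}) (col v i) xs b"

lemma cost_start: "cost v a xs b \<le> of_bool (a \<noteq> c) + cost v c xs b"
  by (cases xs) auto

lemma cost_append:
  assumes "distinct xs"
  shows "cost v a (xs @ ys) c \<le> cost v a xs b + cost (v \<oplus> set xs) b ys c"
  using assms
proof (induction xs arbitrary: v a)
  case Nil
  then show ?case using cost_start[of v a ys c b] by simp
next
  case (Cons i xs)
  then have "cost (v \<oplus> {i}) (col v i) (xs @ ys) c
      \<le> cost (v \<oplus> {i}) (col v i) xs b + cost (v \<oplus> {i} \<oplus> set xs) b ys c"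
    by auto
  with Cons.prems show ?case by (simp add: flip_insert)
qed

lemma cost_snoc: "distinct (xs @ [i]) \<Longrightarrow> 
  cost v a (xs @ [i]) c = cost v a xs (col (v \<oplus> set xs) i) + of_bool (col (v \<oplus> set xs) i \<noteq> c)"
  by (induction xs arbitrary: v a) (auto simp: flip_insert)

text \<open>The first direction becomes the last one, which \<open>cost_snoc\<close> peels off;
  \<open>col_flip\<close> identifies the colour of its edge seen from the other end.\<close>

lemma cost_rev: "distinct xs \<Longrightarrow> cost (v \<oplus> set xs) b (rev xs) a = cost v a xs b"
proof (induction xs arbitrary: v a)
  case (Cons i xs)
  then have i: "i \<notin> set xs" and d: "distinct (rev xs @ [i])" by auto
  have "v \<oplus> {i} \<oplus> set xs \<oplus> set (rev xs) = v \<oplus> {i}" by simp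
  with Cons cost_snoc[OF d] i show ?case by (simp add: flip_insert)
qed auto

text \<open>\<open>k\<close> is only an upper bound and includes changes against the outer colours
  \<open>a\<close> and \<open>b\<close>, which need not be the colours of the first and last
  edges.\<close>

definition walk :: "nat set \<Rightarrow> nat set \<Rightarrow> bool \<Rightarrow> bool \<Rightarrow> nat \<Rightarrow> bool" where
  "walk v S a b k \<longleftrightarrow> (\<exists>xs. distinct xs \<and> set xs = S \<and> cost v a xs b \<le> k)"

lemma walk_mono: "walk v S a b k \<Longrightarrow> k \<le> l \<Longrightarrow> walk v S a b l"
  unfolding walk_def using le_trans by blast

lemma walk_empty: "walk v {} a b (of_bool (a \<noteq> b))"
  unfolding walk_def by (intro exI[of _ "[]"]) auto

lemma walk_single: "walk v {i} (col v i) (col v i) 0"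
  unfolding walk_def by (intro exI[of _ "[i]"]) auto

lemma walk_Un:
  assumes "walk v S a b k" "walk (v \<oplus> S) T b c l" "S \<inter> T = {}"
  shows "walk v (S \<union> T) a c (k + l)"
proof -
  from assms obtain xs ys where "distinct xs" "set xs = S" "cost v a xs b \<le> k"
    and "distinct ys" "set ys = T" "cost (v \<oplus> S) b ys c \<le> l"
    unfolding walk_def by blast
  with cost_append[of xs v a ys c b] assms(3) show ?thesis
    unfolding walk_def by (intro exI[of _ "xs @ ys"]) auto
qed

lemma walk_start: "walk v S a b k \<Longrightarrow> walk v S c b (of_bool (c \<noteq> a) + k)"
proof -
  assume "walk v S a b k"
  then obtain xs where "distinct xs" "set xs = S" "cost v a xs b \<le> k"
    unfolding walk_def by blast
  with cost_start[of v c xs b a] show ?thesis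
    unfolding walk_def by (intro exI[of _ xs]) auto
qed

lemma walk_join:
  assumes "walk v S a b k" "walk (v \<oplus> S) T c d l" "S \<inter> T = {}"
  shows "walk v (S \<union> T) a d (k + l + of_bool (b \<noteq> c))"
  using walk_Un[OF assms(1) walk_start[OF assms(2), of b] assms(3)] by (simp add: ac_simps)

lemma walk_reverse:
  assumes "walk v S a b k"
  shows "walk (v \<oplus> S) S b a k"
proof -
  from assms obtain xs where "distinct xs" "set xs = S" "cost v a xs b \<le> k"
    unfolding walk_def by blast
  with cost_rev[of xs v b a] show ?thesis
    unfolding walk_def by (intro exI[of _ "rev xs"]) auto
qed

text \<open>A single edge between outer colours equal to its own costs nothing, and prepending an
  edge costs at most one change.\<close>

lemma ex_walk_less:
  assumes "finite S" "S \<noteq> {}"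
  shows "\<exists>a b k. walk v S a b k \<and> k < card S"
  using assms
proof (induction S arbitrary: v rule: finite_ne_induct)
  case (singleton i)
  then show ?case using walk_single[of v i] by fastforce
next
  case (insert i S)
  then obtain a b k where "walk (v \<oplus> {i}) S a b k" "k < card S" by blast
  then have "walk v ({i} \<union> S) (col v i) b (0 + k + of_bool (col v i \<noteq> a))"
    using insert.hyps by (intro walk_join[OF walk_single]) auto
  then have "walk v (insert i S) (col v i) b (k + 1)"
    using walk_mono[of v "insert i S" "col v i" b "k + of_bool (col v i \<noteq> a)" "k + 1"] by auto
  with \<open>k < card S\<close> insert.hyps show ?case by (metis Suc_eq_plus1 Suc_less_eq card_insert_disjoint)
qed

primrec realises :: "nat set \<Rightarrow> nat set \<Rightarrow> gadget \<Rightarrow> bool" where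
  "realises v S (Fixed a b k) \<longleftrightarrow> walk v S a b k"
| "realises v S (Flexible t k) \<longleftrightarrow> (\<forall>a. walk v S a (a \<noteq> t) k)"

lemma realises_join:
  assumes "realises v S g" "realises (v \<oplus> S) T h" "S \<inter> T = {}"
  shows "realises v (S \<union> T) (join g h)"
proof (cases g)
  case g: (Fixed a b k)
  show ?thesis
  proof (cases h)
    case (Fixed c d l)
    with g assms walk_join[of v S a b k T c d l] show ?thesis by simp
  next
    case (Flexible t l)
    with g assms show ?thesis by (auto intro: walk_Un)
  qed
next
  case g: (Flexible t k)
  show ?thesis
  proof (cases h)
    case (Fixed c d l)
    \<comment> \<open>The free first colour of \<open>g\<close> is chosen so that its last colour
      becomes \<open>c\<close>, the first colour of \<open>h\<close>.\<close>
    have "walk v S (c \<noteq> t) ((c \<noteq> t) \<noteq> t) k" using g assms(1) by simp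
    moreover have "((c \<noteq> t) \<noteq> t) = c" by auto
    ultimately have "walk v S (c \<noteq> t) c k" by (simp only:)
    with Fixed g assms(2,3) show ?thesis by (auto intro: walk_Un)
  next
    case (Flexible u l)
    have "walk v (S \<union> T) a (a \<noteq> (t \<noteq> u)) (k + l)" for a
    proof -
      have "walk v (S \<union> T) a ((a \<noteq> t) \<noteq> u) (k + l)"
      proof (rule walk_Un)
        show "walk v S a (a \<noteq> t) k" using assms(1) g by simp
        show "walk (v \<oplus> S) T (a \<noteq> t) ((a \<noteq> t) \<noteq> u) l" using assms(2) Flexible by simp
      qed (rule assms(3))
      moreover have "((a \<noteq> t) \<noteq> u) = (a \<noteq> (t \<noteq> u))" by auto
      ultimately show ?thesis by (simp only:)
    qed
    with g Flexible show ?thesis by simp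
  qed
qed

lemma realises_reverse:
  assumes "realises v S g"
  shows "realises (v \<oplus> S) S (reverse g)"
proof (cases g)
  case (Fixed a b k)
  with assms show ?thesis by (simp add: walk_reverse)
next
  case (Flexible t k)
  have "walk (v \<oplus> S) S a (a \<noteq> t) k" for a
  proof -
    have "walk v S (a \<noteq> t) ((a \<noteq> t) \<noteq> t) k" using assms Flexible by simp
    moreover have "((a \<noteq> t) \<noteq> t) = a" by auto
    ultimately have "walk v S (a \<noteq> t) a k" by (simp only:)
    then show ?thesis by (rule walk_reverse)
  qed
  with Flexible show ?thesis by simp
qed

section \<open>Lightest gadgets across a subcube\<close>

definition lightest :: "nat set \<Rightarrow> nat set \<Rightarrow> gadget" where
  "lightest v S = arg_min weight (realises v S)"

text \<open>The case distinction makes the choice of a lightest gadget invariant under reversal.\<close>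

definition block :: "nat set \<Rightarrow> nat set \<Rightarrow> gadget" where
  "block v S = (if Min S \<notin> v then lightest v S else reverse (lightest (v \<oplus> S) S))"

lemma lightest:
  assumes "finite S" "S \<noteq> {}"
  shows "realises v S (lightest v S)" "realises v S g \<Longrightarrow> weight (lightest v S) \<le> weight g"
proof -
  obtain a b k where "realises v S (Fixed a b k)"
    using ex_walk_less[OF assms] by fastforce
  from arg_min_nat_lemma[of "realises v S", OF this]
  show "realises v S (lightest v S)" "realises v S g \<Longrightarrow> weight (lightest v S) \<le> weight g"
    unfolding lightest_def by auto
qed

text \<open>The smallest direction lies in exactly one of \<open>v\<close> and
  \<open>v \<oplus> S\<close>. Hence two antipodal vertices of the subcube use the same gadget, read
  in opposite directions.\<close>

lemma block:
  assumes "finite S" "S \<noteq> {}"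
  shows realises_block: "realises v S (block v S)"
    and weight_block_le: "realises v S g \<Longrightarrow> weight (block v S) \<le> weight g"
    and block_flip: "block (v \<oplus> S) S = reverse (block v S)"
proof -
  show "realises v S (block v S)"
    using lightest(1)[OF assms] realises_reverse[of "v \<oplus> S" S] by (auto simp: block_def)
  show "weight (block v S) \<le> weight g" if "realises v S g"
    using lightest(2)[OF assms that] lightest(2)[OF assms realises_reverse[OF that]]
    by (auto simp: block_def)
  have "Min S \<in> S" using assms by simp
  then have "Min S \<in> v \<oplus> S \<longleftrightarrow> Min S \<notin> v" by (auto simp: flip_def)
  then show "block (v \<oplus> S) S = reverse (block v S)"
    by (auto simp: block_def)
qed

lemma weight_block_flip: "finite S \<Longrightarrow> S \<noteq> {} \<Longrightarrow> weight (block (v \<oplus> S) S) = weight (block v S)"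
  by (simp add: block_flip)

lemma weight_block_less: 
  assumes "finite S" "S \<noteq> {}"
  shows "weight (block v S) < 2 * card S"
proof -
  obtain a b k where "realises v S (Fixed a b k)" "k < card S"
    using ex_walk_less[OF assms] by fastforce
  from weight_block_le[OF assms this(1)] this(2) show ?thesis by simp
qed

end

section \<open>Random vertices and orders of the coordinates\<close>

text \<open>The expectation for a uniform start vertex and an independent uniform order of the
  directions.\<close>

definition mean :: "nat \<Rightarrow> (nat set \<Rightarrow> (nat \<Rightarrow> nat) \<Rightarrow> real) \<Rightarrow> real" where
  "mean n f = (\<Sum>v\<in>Pow {..<n}. \<Sum>\<pi> | \<pi> permutes {..<n}. f v \<pi>) / (2 ^ n * fact n)"

lemma mean_mono:
  assumes "\<And>v \<pi>. v \<subseteq> {..<n} \<Longrightarrow> \<pi> permutes {..<n} \<Longrightarrow> f v \<pi> \<le> g v \<pi>"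
  shows "mean n f \<le> mean n g"
  unfolding mean_def using assms by (intro divide_right_mono sum_mono) auto

lemma mean_cong:
  assumes "\<And>v \<pi>. v \<subseteq> {..<n} \<Longrightarrow> \<pi> permutes {..<n} \<Longrightarrow> f v \<pi> = g v \<pi>"
  shows "mean n f = mean n g"
  unfolding mean_def using assms by simp

lemma mean_const [simp]: "mean n (\<lambda>v \<pi>. c) = c"
  by (simp add: mean_def card_Pow card_permutations[OF refl])

lemma mean_add: "mean n (\<lambda>v \<pi>. f v \<pi> + g v \<pi>) = mean n f + mean n g"
  by (simp add: mean_def sum.distrib add_divide_distrib)

lemma mean_diff: "mean n (\<lambda>v \<pi>. f v \<pi> - g v \<pi>) = mean n f - mean n g"
  by (simp add: mean_def sum_subtractf diff_divide_distrib)

lemma mean_cmult: "mean n (\<lambda>v \<pi>. c * f v \<pi>) = c * mean n f"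
  by (simp add: mean_def sum_distrib_left)

lemma mean_sum: "mean n (\<lambda>v \<pi>. \<Sum>i\<in>A. f i v \<pi>) = (\<Sum>i\<in>A. mean n (f i))"
proof (cases "finite A")
  case True
  then show ?thesis
    by (induction A rule: finite_induct) (simp_all add: mean_add)
qed simp

lemma ex_le_mean: "\<exists>v \<pi>. v \<subseteq> {..<n} \<and> \<pi> permutes {..<n} \<and> f v \<pi> \<le> mean n f"
proof (rule ccontr)
  assume "\<not> ?thesis"
  then have less: "mean n f < f v \<pi>" if "v \<subseteq> {..<n}" "\<pi> permutes {..<n}" for v \<pi>
    using that not_le by blast
  have ne: "{\<pi>. \<pi> permutes {..<n}} \<noteq> {}"
    using permutes_id[of "{..<n}"] by blast
  have "(\<Sum>\<pi> | \<pi> permutes {..<n}. mean n f) < (\<Sum>\<pi> | \<pi> permutes {..<n}. f v \<pi>)"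
    if "v \<in> Pow {..<n}" for v
    using that less by (intro sum_strict_mono finite_permutations ne) auto
  then have "(\<Sum>v\<in>Pow {..<n}. \<Sum>\<pi> | \<pi> permutes {..<n}. mean n f)
      < (\<Sum>v\<in>Pow {..<n}. \<Sum>\<pi> | \<pi> permutes {..<n}. f v \<pi>)"
    by (rule sum_strict_mono[rotated 2]) auto
  then have "mean n (\<lambda>v \<pi>. mean n f) < mean n f"
    unfolding mean_def[of n f] mean_def[of n "\<lambda>v \<pi>. K" for K]
    by (intro divide_strict_right_mono) auto
  then show False by simp
qed

text \<open>For fixed \<open>\<pi>\<close> the shift by \<open>A \<pi>\<close> permutes the
  vertices, so the shifted vertex is again uniform and independent of \<open>\<pi>\<close>.\<close>

lemma mean_flip:
  assumes "\<And>\<pi>. \<pi> permutes {..<n} \<Longrightarrow> A \<pi> \<subseteq> {..<n}"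
  shows "mean n (\<lambda>v \<pi>. f (v \<oplus> A \<pi>) \<pi>) = mean n f"
proof -
  have "(\<Sum>v\<in>Pow {..<n}. f (v \<oplus> A \<pi>) \<pi>) = (\<Sum>v\<in>Pow {..<n}. f v \<pi>)" if "\<pi> permutes {..<n}" for \<pi>
    by (rule sum.reindex_bij_betw[OF bij_betw_flip[OF assms[OF that]]])
  then have "(\<Sum>\<pi> | \<pi> permutes {..<n}. \<Sum>v\<in>Pow {..<n}. f (v \<oplus> A \<pi>) \<pi>)
      = (\<Sum>\<pi> | \<pi> permutes {..<n}. \<Sum>v\<in>Pow {..<n}. f v \<pi>)"
    by (rule sum.cong[OF refl]) simp
  then show ?thesis
    unfolding mean_def by (subst (1 2) sum.swap) simp
qed

lemma mean_compose:
  assumes "\<rho> permutes {..<n}"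
  shows "mean n (\<lambda>v \<pi>. f v (\<pi> \<circ> \<rho>)) = mean n f"
proof -
  have "bij_betw (\<lambda>\<pi>. \<pi> \<circ> \<rho>) {\<pi>. \<pi> permutes {..<n}} {\<pi>. \<pi> permutes {..<n}}"
    by (rule bij_betw_byWitness[where f' = "\<lambda>\<pi>. \<pi> \<circ> inv \<rho>"])
      (auto simp: comp_assoc permutes_inv_o[OF assms] intro: permutes_compose assms permutes_inv)
  from sum.reindex_bij_betw[OF this, of "f v" for v] show ?thesis
    unfolding mean_def by simp
qed

text \<open>A permutation that is right on the tails is corrected at \<open>p\<close> by one
  transposition, which moves no element of \<open>qs\<close>.\<close>

lemma ex_permutes_map:
  assumes "length ps = length qs" "distinct ps" "distinct qs" "set ps \<subseteq> I" "set qs \<subseteq> I"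
  shows "\<exists>\<rho>. \<rho> permutes I \<and> map \<rho> ps = qs"
  using assms
proof (induction ps qs rule: list_induct2)
  case Nil
  show ?case by (rule exI[of _ id], rule conjI[OF permutes_id]) simp
next
  case (Cons p ps q qs)
  then obtain \<rho> where \<rho>: "\<rho> permutes I" "map \<rho> ps = qs" by auto
  have "\<rho> p \<notin> set qs"
    using Cons.prems \<rho> by (auto simp: inj_eq[OF permutes_inj[OF \<rho>(1)]])
  then have "transpose (\<rho> p) q x = x" if "x \<in> set qs" for x
    using that Cons.prems by (intro transpose_apply_other) auto
  then have "map (transpose (\<rho> p) q) qs = qs"
    by (simp add: map_idI)
  then have "map (transpose (\<rho> p) q \<circ> \<rho>) (p # ps) = q # qs"
    by (simp add: \<rho>(2) flip: map_map)
  moreover have "\<rho> p \<in> I" using \<rho>(1) Cons.prems by (simp add: permutes_in_image)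
  then have "transpose (\<rho> p) q \<circ> \<rho> permutes I"
    using Cons.prems by (intro permutes_compose \<rho>(1) permutes_swap_id) auto
  ultimately show ?case by (intro exI conjI)
qed

text \<open>Exchangeability: \<open>\<pi> \<circ> \<rho>\<close> is as uniform as
  \<open>\<pi>\<close>, so it does not matter which distinct positions of \<open>\<pi>\<close> are
  read.\<close>

lemma mean_exchange:
  assumes "length ps = length qs" "distinct ps" "distinct qs" "set ps \<subseteq> {..<n}" "set qs \<subseteq> {..<n}"
  shows "mean n (\<lambda>v \<pi>. f v (map \<pi> ps)) = mean n (\<lambda>v \<pi>. f v (map \<pi> qs))"
proof -
  from ex_permutes_map[OF assms] obtain \<rho> where "\<rho> permutes {..<n}" "map \<rho> ps = qs" by blast
  then show ?thesis
    using mean_compose[of \<rho> n "\<lambda>v \<pi>. f v (map \<pi> ps)"] by (simp flip: map_map)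
qed

section \<open>Vertices and segments along a random geodesic\<close>

abbreviation vertex :: "nat set \<Rightarrow> (nat \<Rightarrow> nat) \<Rightarrow> nat \<Rightarrow> nat set" where
  "vertex v \<pi> k \<equiv> v \<oplus> \<pi> ` {..<k}"

abbreviation segment :: "(nat \<Rightarrow> nat) \<Rightarrow> nat \<Rightarrow> nat \<Rightarrow> nat list" where
  "segment \<pi> k b \<equiv> map \<pi> [k..<k + b]"

lemma mean_vertex:
  assumes "k \<le> n"
  shows "mean n (\<lambda>v \<pi>. f (vertex v \<pi> k) \<pi>) = mean n f"
proof (rule mean_flip)
  show "\<pi> ` {..<k} \<subseteq> {..<n}" if "\<pi> permutes {..<n}" for \<pi>
    using permutes_image[OF that] assms by (metis image_mono lessThan_subset_iff)
qed

lemma vertex_add: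
  assumes "\<pi> permutes {..<n}"
  shows "vertex v \<pi> k \<oplus> set (segment \<pi> k b) = vertex v \<pi> (k + b)"
proof -
  have "{..<k + b} = {..<k} \<union> {k..<k + b}" by auto
  moreover have "\<pi> ` {..<k} \<inter> \<pi> ` {k..<k + b} = {}"
    by (subst image_Int[OF permutes_inj[OF assms], symmetric]) auto
  ultimately show ?thesis by (simp add: image_Un flip_Un)
qed

lemma mean_segment:
  assumes "k + b \<le> n"
  shows "mean n (\<lambda>v \<pi>. f (vertex v \<pi> k) (segment \<pi> k b)) = mean n (\<lambda>v \<pi>. f v (segment \<pi> 0 b))"
proof -
  have "mean n (\<lambda>v \<pi>. f (vertex v \<pi> k) (segment \<pi> k b)) = mean n (\<lambda>v \<pi>. f v (segment \<pi> k b))"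
    using assms by (intro mean_vertex) auto
  also have "\<dots> = mean n (\<lambda>v \<pi>. f v (segment \<pi> 0 b))"
    using assms by (intro mean_exchange) auto
  finally show ?thesis .
qed

text \<open>Averaging over the disjoint segments of one permutation turns the correlation of two of them
  into a square, up to the diagonal terms. This is why a random junction is not worse than a fair coin.\<close>

lemma mean_junction:
  fixes g :: "nat set \<Rightarrow> nat list \<Rightarrow> gadget"
  assumes rev: "\<And>v xs. distinct xs \<Longrightarrow> length xs = b \<Longrightarrow> g (v \<oplus> set xs) (rev xs) = reverse (g v xs)"
    and b: "0 < b" "k + 2 * b \<le> n"
  shows "- 1 / (real (n div b) - 1) \<le> mean n (\<lambda>v \<pi>. 
    spin (reverse (g (vertex v \<pi> k) (segment \<pi> k b))) * spin (g (vertex v \<pi> (k + b)) (segment \<pi> (k + b) b)))"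
    (is "_ \<le> mean n ?f")
proof -
  define K where "K = n div b"
  have "2 * b \<le> n" using b by simp
  then have "2 \<le> K" unfolding K_def using b(1) by (simp add: less_eq_div_iff_mult_less_eq)
  have Kb: "t * b + b \<le> n" if "t < K" for t
  proof -
    have "Suc t * b \<le> K * b" using that by (intro mult_right_mono) auto
    also have "\<dots> \<le> n" unfolding K_def by simp
    finally show ?thesis by simp
  qed
  define s where "s v xs = spin (g v xs)" for v xs
  define F where "F v zs = s v (take b zs) * s v (drop b zs)" for v zs
  define ps where "ps t = [t * b..<t * b + b]" for t
  \<comment> \<open>Seen from the common vertex, the reversed first walk starts there as well. Both
    factors thus become the same function \<open>s\<close> at one vertex, applied to disjoint lists
    of directions.\<close>
  have "mean n ?f = mean n (\<lambda>v \<pi>. F (vertex v \<pi> (k + b)) (map \<pi> (rev [k..<k + b] @ [k + b..<k + b + b])))"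
  proof (rule mean_cong)
    fix v \<pi> assume \<pi>: "\<pi> permutes {..<n}"
    have "distinct (segment \<pi> k b)"
      by (simp add: distinct_map inj_on_subset[OF permutes_inj[OF \<pi>] subset_UNIV])
    from rev[OF this, of "vertex v \<pi> k"] vertex_add[OF \<pi>, of v k b]
    show "?f v \<pi> = F (vertex v \<pi> (k + b)) (map \<pi> (rev [k..<k + b] @ [k + b..<k + b + b]))"
      by (simp add: F_def s_def rev_map)
  qed
  also have "\<dots> = mean n (\<lambda>v \<pi>. F v (map \<pi> (rev [k..<k + b] @ [k + b..<k + b + b])))"
    using b by (intro mean_vertex[where f = "\<lambda>v \<pi>. F v (map \<pi> (rev [k..<k + b] @ [k + b..<k + b + b]))"]) auto
  finally have f: "mean n ?f = \<dots>" .
  have ex: "mean n ?f = mean n (\<lambda>v \<pi>. s v (map \<pi> (ps t)) * s v (map \<pi> (ps u)))"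
    if "t < K" "u < K" "t \<noteq> u" for t u
  proof -
    have "t * b + b \<le> u * b \<or> u * b + b \<le> t * b"
    proof (cases "t < u")
      case True
      then have "Suc t * b \<le> u * b" by (intro mult_right_mono) auto
      then show ?thesis by simp
    next
      case False
      then have "Suc u * b \<le> t * b" using that by (intro mult_right_mono) auto
      then show ?thesis by simp
    qed
    then have "mean n ?f = mean n (\<lambda>v \<pi>. F v (map \<pi> (ps t @ ps u)))"
      unfolding f using b Kb[OF that(1)] Kb[OF that(2)] by (intro mean_exchange[where f = F]) (auto simp: ps_def)
    also have "\<dots> = mean n (\<lambda>v \<pi>. s v (map \<pi> (ps t)) * s v (map \<pi> (ps u)))"
      by (simp add: F_def ps_def)
    finally show ?thesis .
  qed
  have sq: "(\<Sum>t<K. \<Sum>u\<in>{..<K} - {t}. x t * x u) = (\<Sum>t<K. x t)\<^sup>2 - (\<Sum>t<K. (x t)\<^sup>2)" for x :: "nat \<Rightarrow> real"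
  proof -
    have "(\<Sum>u\<in>{..<K} - {t}. x t * x u) = x t * (\<Sum>u<K. x u) - (x t)\<^sup>2" if "t < K" for t
      using that by (simp add: sum_diff1 right_diff_distrib power2_eq_square flip: sum_distrib_left)
    then show ?thesis
      by (simp add: sum_subtractf power2_eq_square flip: sum_distrib_right)
  qed
  have "- real K \<le> mean n (\<lambda>v \<pi>. \<Sum>t<K. \<Sum>u\<in>{..<K} - {t}. s v (map \<pi> (ps t)) * s v (map \<pi> (ps u)))"
  proof -
    have "- real K \<le> (\<Sum>t<K. \<Sum>u\<in>{..<K} - {t}. s v (map \<pi> (ps t)) * s v (map \<pi> (ps u)))" for v \<pi>
    proof -
      have "(\<Sum>t<K. (s v (map \<pi> (ps t)))\<^sup>2) \<le> (\<Sum>t<K. 1)"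
        unfolding s_def by (intro sum_mono spin_sq_le)
      also have "\<dots> = real K" by simp
      finally show ?thesis
        unfolding sq using zero_le_power2[of "\<Sum>t<K. s v (map \<pi> (ps t))"] by linarith
    qed
    then have "mean n (\<lambda>v \<pi>. - real K) \<le> mean n (\<lambda>v \<pi>. \<Sum>t<K. \<Sum>u\<in>{..<K} - {t}. s v (map \<pi> (ps t)) * s v (map \<pi> (ps u)))"
      by (intro mean_mono) auto
    then show ?thesis by simp
  qed
  also have "\<dots> = (\<Sum>t<K. \<Sum>u\<in>{..<K} - {t}. mean n ?f)"
    unfolding mean_sum using ex by (intro sum.cong refl) auto
  also have "\<dots> = real K * ((real K - 1) * mean n ?f)"
    using \<open>2 \<le> K\<close> by (simp add: of_nat_diff)
  finally have "real K * - 1 \<le> real K * ((real K - 1) * mean n ?f)"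
    by simp
  then have "- 1 \<le> (real K - 1) * mean n ?f"
    using \<open>2 \<le> K\<close> by (subst (asm) mult_le_cancel_left_pos) auto
  then show ?thesis
    using \<open>2 \<le> K\<close> by (simp add: K_def field_simps)
qed

section \<open>Merging blocks\<close>

context cube_colouring
begin

primrec chunk :: "nat \<Rightarrow> nat set \<Rightarrow> nat list \<Rightarrow> gadget" where
  "chunk 0 v xs = block v (set xs)"
| "chunk (Suc l) v xs = join (chunk l v (take (4 * 2 ^ l) xs))
    (chunk l (v \<oplus> set (take (4 * 2 ^ l) xs)) (drop (4 * 2 ^ l) xs))"

text \<open>Reversal exchanges the two equally long halves, so the symmetry of blocks is inherited
  level by level.\<close>

lemma chunk:
  assumes "length xs = 4 * 2 ^ l" "distinct xs"
  shows "realises v (set xs) (chunk l v xs)"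
    and "chunk l (v \<oplus> set xs) (rev xs) = reverse (chunk l v xs)"
proof -
  have "realises v (set xs) (chunk l v xs) \<and> chunk l (v \<oplus> set xs) (rev xs) = reverse (chunk l v xs)"
    using assms
  proof (induction l arbitrary: v xs)
    case 0
    then have "xs \<noteq> []" by auto
    then show ?case using realises_block[of "set xs" v] block_flip[of "set xs" v] by simp
  next
    case (Suc l)
    define ys zs where "ys = take (4 * 2 ^ l) xs" and "zs = drop (4 * 2 ^ l) xs"
    have xs: "xs = ys @ zs" by (simp add: ys_def zs_def)
    have len: "length ys = 4 * 2 ^ l" "length zs = 4 * 2 ^ l"
      using Suc.prems(1) by (auto simp: ys_def zs_def)
    have dist: "distinct ys" "distinct zs" "set ys \<inter> set zs = {}"
      using Suc.prems(2) unfolding xs by auto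
    note IH = Suc.IH[OF len(1) dist(1)] Suc.IH[OF len(2) dist(2)]
    have "realises v (set ys \<union> set zs) (join (chunk l v ys) (chunk l (v \<oplus> set ys) zs))"
      using IH dist(3) by (intro realises_join) auto
    moreover have "chunk (Suc l) (v \<oplus> set ys \<oplus> set zs) (rev zs @ rev ys)
        = join (chunk l (v \<oplus> set ys \<oplus> set zs) (rev zs)) (chunk l (v \<oplus> set ys) (rev ys))"
      using len by simp
    then have "chunk (Suc l) (v \<oplus> set ys \<oplus> set zs) (rev zs @ rev ys)
        = reverse (join (chunk l v ys) (chunk l (v \<oplus> set ys) zs))"
      using IH by (simp add: reverse_join)
    ultimately show ?case
      using len dist(3) by (simp add: xs flip_Un)
  qed
  then show "realises v (set xs) (chunk l v xs)" "chunk l (v \<oplus> set xs) (rev xs) = reverse (chunk l v xs)"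
    by auto
qed

definition mean_weight :: "nat \<Rightarrow> nat \<Rightarrow> real" where
  "mean_weight n l = mean n (\<lambda>v \<pi>. weight (chunk l v (segment \<pi> 0 (4 * 2 ^ l))))"

text \<open>Both halves have the same mean by exchangeability; the spin product in
  \<open>weight_join\<close> is controlled by \<open>mean_junction\<close>.\<close>

lemma mean_weight_Suc:
  assumes "4 * 2 ^ Suc l \<le> n"
  shows "mean_weight n (Suc l) \<le> 2 * mean_weight n l + 1 / (real (n div (4 * 2 ^ l)) - 1)"
proof -
  define b :: nat where "b = 4 * 2 ^ l"
  have b: "0 < b" "2 * b \<le> n" using assms by (auto simp: b_def)
  let ?J = "\<lambda>v \<pi>. spin (reverse (chunk l (vertex v \<pi> 0) (segment \<pi> 0 b))) * spin (chunk l (vertex v \<pi> (0 + b)) (segment \<pi> (0 + b) b))"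
  have "mean_weight n (Suc l) = mean n (\<lambda>v \<pi>. weight (chunk l v (segment \<pi> 0 b))
      + weight (chunk l (vertex v \<pi> b) (segment \<pi> b b)) - ?J v \<pi>)"
    unfolding mean_weight_def
  proof (rule mean_cong)
    fix v \<pi>
    have "[0..<0 + 4 * 2 ^ Suc l] = [0..<b] @ [b..<b + b]"
      using upt_add_eq_append[of 0 b b] by (simp add: b_def)
    then have "chunk (Suc l) v (segment \<pi> 0 (4 * 2 ^ Suc l))
        = join (chunk l v (segment \<pi> 0 b)) (chunk l (vertex v \<pi> b) (segment \<pi> b b))"
      unfolding chunk.simps b_def[symmetric] by (simp add: atLeast0LessThan)
    then show "real (weight (chunk (Suc l) v (segment \<pi> 0 (4 * 2 ^ Suc l)))) = weight (chunk l v (segment \<pi> 0 b))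
      + weight (chunk l (vertex v \<pi> b) (segment \<pi> b b)) - ?J v \<pi>"
      by (simp only: weight_join) simp
  qed
  also have "\<dots> = 2 * mean_weight n l - mean n ?J"
    using mean_segment[of b b n "\<lambda>v xs. weight (chunk l v xs)"] b
    unfolding of_nat_add mean_add mean_diff mean_weight_def b_def[symmetric] by simp
  finally have "mean_weight n (Suc l) = 2 * mean_weight n l - mean n ?J" .
  moreover have "- 1 / (real (n div b) - 1) \<le> mean n ?J"
  proof (rule mean_junction)
    show "chunk l (v \<oplus> set xs) (rev xs) = reverse (chunk l v xs)" if "distinct xs" "length xs = b" for v xs
      using that by (intro chunk(2)) (auto simp: b_def)
  qed (use b in auto)
  ultimately show ?thesis unfolding b_def by linarith
qed

text \<open>The first colour is chosen by a rule that is invariant under reversal.\<close>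

definition orient :: "nat set \<Rightarrow> nat set \<Rightarrow> gadget \<Rightarrow> gadget" where
  "orient v S g = (case g of Flexible t k \<Rightarrow> Fixed (t \<longrightarrow> Min S \<in> v) ((t \<longrightarrow> Min S \<in> v) \<noteq> t) k | _ \<Rightarrow> g)"

lemma realises_orient: "realises v S g \<Longrightarrow> realises v S (orient v S g)"
  by (cases g) (auto simp: orient_def)

lemma weight_orient: "weight (orient v S g) \<le> weight g + 1"
  by (cases g) (auto simp: orient_def)

lemma spin_orient: "spin (orient v S g) \<noteq> 0" "spin (reverse (orient v S g)) \<noteq> 0"
  by (cases g; simp add: orient_def)+

text \<open>If both end colours agree, they are always set to \<open>True\<close>. If they differ,
  the first one is decided by \<open>Min S \<in> v\<close>, which changes its truth value at the
  other end.\<close>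

lemma orient_reverse:
  assumes "finite S" "S \<noteq> {}"
  shows "orient (v \<oplus> S) S (reverse g) = reverse (orient v S g)"
proof -
  have "Min S \<in> S" using assms by simp
  then have "Min S \<in> v \<oplus> S \<longleftrightarrow> Min S \<notin> v" by (auto simp: flip_def)
  then show ?thesis by (cases g) (auto simp: orient_def)
qed

section \<open>Superblocks of 32 edges and their concatenation\<close>

definition superblock :: "nat set \<Rightarrow> nat list \<Rightarrow> gadget" where
  "superblock v xs = orient v (set xs) (chunk 3 v xs)"

lemma superblock:
  assumes "length xs = 32" "distinct xs"
  shows "realises v (set xs) (superblock v xs)"
    and "superblock (v \<oplus> set xs) (rev xs) = reverse (superblock v xs)"
proof -
  have ch: "realises v (set xs) (chunk 3 v xs)" "chunk 3 (v \<oplus> set xs) (rev xs) = reverse (chunk 3 v xs)"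
    using assms by (simp_all add: chunk)
  have "xs \<noteq> []" using assms by auto
  then show "superblock (v \<oplus> set xs) (rev xs) = reverse (superblock v xs)"
    by (simp add: superblock_def ch(2) orient_reverse)
  show "realises v (set xs) (superblock v xs)"
    by (simp add: superblock_def ch(1) realises_orient)
qed

text \<open>The empty walk \<open>Flexible False 0\<close> is neutral for
  \<open>join\<close>.\<close>

primrec supers :: "nat set \<Rightarrow> (nat \<Rightarrow> nat) \<Rightarrow> nat \<Rightarrow> gadget" where
  "supers v \<pi> 0 = Flexible False 0"
| "supers v \<pi> (Suc m) = join (supers v \<pi> m) (superblock (vertex v \<pi> (32 * m)) (segment \<pi> (32 * m) 32))"

lemma spin_join: "spin (reverse h) \<noteq> 0 \<Longrightarrow> spin (reverse (join g h)) = spin (reverse h)"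
  by (cases g; cases h) auto

text \<open>This is what the half change in \<open>weight_orient\<close> buys: as superblocks are
  fixed, the last colour of a chain depends on its last superblock only. So each junction compares
  two neighbours of equal length, and \<open>mean_junction\<close> applies.\<close>

lemma spin_supers: "spin (reverse (supers v \<pi> (Suc m)))
    = spin (reverse (superblock (vertex v \<pi> (32 * m)) (segment \<pi> (32 * m) 32)))"
  by (simp add: spin_join superblock_def spin_orient)

lemma segment_simps:
  assumes "\<pi> permutes {..<n}"
  shows "distinct (segment \<pi> k b)" "\<pi> ` {..<k} \<inter> set (segment \<pi> k b) = {}"
    "\<pi> ` {..<k} \<union> set (segment \<pi> k b) = \<pi> ` {..<k + b}"
proof -
  show "distinct (segment \<pi> k b)"
    by (simp add: distinct_map inj_on_subset[OF permutes_inj[OF assms] subset_UNIV])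
  show "\<pi> ` {..<k} \<inter> set (segment \<pi> k b) = {}"
    by (simp, subst image_Int[OF permutes_inj[OF assms], symmetric]) auto
  have "{..<k + b} = {..<k} \<union> {k..<k + b}" by auto
  then show "\<pi> ` {..<k} \<union> set (segment \<pi> k b) = \<pi> ` {..<k + b}"
    by (simp add: image_Un)
qed

lemma realises_segment:
  assumes "\<pi> permutes {..<n}" "realises v (\<pi> ` {..<k}) g" "realises (vertex v \<pi> k) (set (segment \<pi> k b)) h"
  shows "realises v (\<pi> ` {..<k + b}) (join g h)"
  using realises_join[OF assms(2,3)] segment_simps[OF assms(1), of k b] by simp

lemma realises_supers:
  assumes "\<pi> permutes {..<n}"
  shows "realises v (\<pi> ` {..<32 * m}) (supers v \<pi> m)"
proof (induction m)
  case 0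
  show ?case using walk_empty[of v] by (auto simp: walk_def)
next
  case (Suc m)
  have "realises v (\<pi> ` {..<32 * m + 32}) (supers v \<pi> (Suc m))"
    unfolding supers.simps
    by (rule realises_segment[OF assms Suc.IH]) (rule superblock; simp add: segment_simps(1)[OF assms])
  then show ?case by (simp add: add.commute)
qed

lemma mean_superblock: "32 * m + 32 \<le> n \<Longrightarrow>
  mean n (\<lambda>v \<pi>. weight (superblock (vertex v \<pi> (32 * m)) (segment \<pi> (32 * m) 32))) \<le> mean_weight n 3 + 1"
proof -
  assume "32 * m + 32 \<le> n"
  then have "mean n (\<lambda>v \<pi>. weight (superblock (vertex v \<pi> (32 * m)) (segment \<pi> (32 * m) 32)))
    = mean n (\<lambda>v \<pi>. weight (superblock v (segment \<pi> 0 32)))"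
    by (rule mean_segment[of "32 * m" 32 n "\<lambda>v xs. weight (superblock v xs)"])
  also have "\<dots> \<le> mean n (\<lambda>v \<pi>. real (weight (chunk 3 v (segment \<pi> 0 32))) + 1)"
  proof (rule mean_mono)
    show "real (weight (superblock v (segment \<pi> 0 32))) \<le> real (weight (chunk 3 v (segment \<pi> 0 32))) + 1" for v \<pi>
      using weight_orient[of v "set (segment \<pi> 0 32)" "chunk 3 v (segment \<pi> 0 32)"]
      unfolding superblock_def by linarith
  qed
  also have "\<dots> = mean_weight n 3 + 1"
    by (simp add: mean_add mean_weight_def)
  finally show ?thesis .
qed

lemma mean_supers:
  assumes "32 * Suc m \<le> n"
  shows "mean n (\<lambda>v \<pi>. weight (supers v \<pi> (Suc m)))
    \<le> real (Suc m) * (mean_weight n 3 + 1) + real m / (real (n div 32) - 1)"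
  using assms
proof (induction m)
  case 0
  have "join (Flexible False 0) g = g" for g by (cases g) auto
  with mean_superblock[of 0 n] 0 show ?case by simp
next
  case (Suc m)
  let ?S = "\<lambda>k v \<pi>. superblock (vertex v \<pi> k) (segment \<pi> k 32)"
  let ?J = "\<lambda>v \<pi>. spin (reverse (?S (32 * m) v \<pi>)) * spin (?S (32 * m + 32) v \<pi>)"
  have "real (weight (supers v \<pi> (Suc (Suc m)))) = weight (supers v \<pi> (Suc m)) + weight (?S (32 * Suc m) v \<pi>) - ?J v \<pi>" for v \<pi>
    unfolding supers.simps(2)[of v \<pi> "Suc m"] weight_join spin_supers by (simp add: add.commute)
  then have "mean n (\<lambda>v \<pi>. weight (supers v \<pi> (Suc (Suc m))))
    = mean n (\<lambda>v \<pi>. weight (supers v \<pi> (Suc m))) + mean n (\<lambda>v \<pi>. weight (?S (32 * Suc m) v \<pi>)) - mean n ?J"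
    by (simp only: of_nat_add mean_add mean_diff)
  moreover have "- 1 / (real (n div 32) - 1) \<le> mean n ?J"
    by (rule mean_junction[of 32 superblock, OF superblock(2)]) (use Suc.prems in simp_all)
  moreover have "mean n (\<lambda>v \<pi>. weight (?S (32 * Suc m) v \<pi>)) \<le> mean_weight n 3 + 1"
    using Suc.prems by (intro mean_superblock) simp
  moreover have "real (Suc (Suc m)) * (mean_weight n 3 + 1) + real (Suc m) / (real (n div 32) - 1)
    = (real (Suc m) * (mean_weight n 3 + 1) + real m / (real (n div 32) - 1)) + (mean_weight n 3 + 1) + 1 / (real (n div 32) - 1)"
    by (simp add: algebra_simps add_divide_distrib)
  moreover have "mean n (\<lambda>v \<pi>. weight (supers v \<pi> (Suc m))) \<le> real (Suc m) * (mean_weight n 3 + 1) + real m / (real (n div 32) - 1)"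
    using Suc by simp
  ultimately show ?case by linarith
qed

section \<open>Leftover blocks and single edges\<close>

primrec blocks :: "nat set \<Rightarrow> (nat \<Rightarrow> nat) \<Rightarrow> nat \<Rightarrow> nat \<Rightarrow> gadget" where
  "blocks v \<pi> m 0 = supers v \<pi> m"
| "blocks v \<pi> m (Suc q) = join (blocks v \<pi> m q)
    (block (vertex v \<pi> (32 * m + 4 * q)) (set (segment \<pi> (32 * m + 4 * q) 4)))"

primrec edges :: "nat set \<Rightarrow> (nat \<Rightarrow> nat) \<Rightarrow> nat \<Rightarrow> nat \<Rightarrow> nat \<Rightarrow> gadget" where
  "edges v \<pi> m q 0 = blocks v \<pi> m q"
| "edges v \<pi> m q (Suc r) = (let k = 32 * m + 4 * q + r; c = col (vertex v \<pi> k) (\<pi> k)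
    in join (edges v \<pi> m q r) (Fixed c c 0))"

lemma realises_edges:
  assumes "\<pi> permutes {..<n}"
  shows "realises v (\<pi> ` {..<32 * m + 4 * q + r}) (edges v \<pi> m q r)"
proof (induction r)
  case 0
  show ?case
  proof (induction q)
    case 0
    show ?case using realises_supers[OF assms, of v m] by simp
  next
    case (Suc q)
    have "realises v (\<pi> ` {..<(32 * m + 4 * q) + 4}) (blocks v \<pi> m (Suc q))"
      unfolding blocks.simps
      by (rule realises_segment[OF assms]) (use Suc.IH in \<open>simp_all add: realises_block\<close>)
    then show ?case by (simp add: add.commute add.left_commute)
  qed
next
  case (Suc r)
  let ?k = "32 * m + 4 * q + r"
  have "realises v (\<pi> ` {..<?k + 1}) (edges v \<pi> m q (Suc r))"
    unfolding edges.simps Let_def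
    by (rule realises_segment[OF assms Suc.IH]) (simp add: walk_single)
  then show ?case by simp
qed


lemma join_Fixed: "(\<exists>a b k. g = Fixed a b k) \<or> (\<exists>a b k. h = Fixed a b k) \<Longrightarrow> \<exists>a b k. join g h = Fixed a b k"
  by (cases g; cases h) auto

text \<open>The weight of a fixed gadget is \<open>2 * k + 1\<close> rather than
  \<open>2 * k\<close>, which gains half a change in the final estimate.\<close>

lemma edges_Fixed:
  assumes "0 < m"
  shows "\<exists>a b k. edges v \<pi> m q r = Fixed a b k"
proof -
  from assms obtain m' where m: "m = Suc m'" by (cases m) auto
  have "\<exists>a b k. superblock u xs = Fixed a b k" for u xs
    using spin_orient(1)[of u "set xs" "chunk 3 u xs"] unfolding superblock_def
    by (cases "orient u (set xs) (chunk 3 u xs)") auto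
  then have "\<exists>a b k. supers v \<pi> m = Fixed a b k"
    unfolding m supers.simps by (intro join_Fixed disjI2)
  then have "\<exists>a b k. blocks v \<pi> m q = Fixed a b k"
    by (induction q) (auto intro: join_Fixed)
  then show ?thesis
    by (induction r) (auto intro: join_Fixed simp: Let_def)
qed

text \<open>A single edge has weight 1, and its junction adds at most one more half change.\<close>

lemma weight_edges: "weight (edges v \<pi> m q r) \<le> weight (blocks v \<pi> m q) + 2 * r"
proof (induction r)
  case (Suc r)
  let ?c = "col (vertex v \<pi> (32 * m + 4 * q + r)) (\<pi> (32 * m + 4 * q + r))"
  have "weight (edges v \<pi> m q (Suc r)) \<le> weight (edges v \<pi> m q r) + weight (Fixed ?c ?c 0) + 1"
    unfolding edges.simps Let_def by (rule weight_join_le)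
  with Suc.IH show ?case by simp
qed simp

text \<open>At most seven blocks are left over in the application, so the worst case at each of
  their junctions is affordable.\<close>

lemma mean_blocks:
  assumes "32 * m + 4 * q \<le> n"
  shows "mean n (\<lambda>v \<pi>. weight (blocks v \<pi> m q))
    \<le> mean n (\<lambda>v \<pi>. weight (supers v \<pi> m)) + real q * (mean_weight n 0 + 1)"
  using assms
proof (induction q)
  case (Suc q)
  let ?B = "\<lambda>v \<pi>. block (vertex v \<pi> (32 * m + 4 * q)) (set (segment \<pi> (32 * m + 4 * q) 4))"
  have "mean n (\<lambda>v \<pi>. weight (blocks v \<pi> m (Suc q))) \<le> mean n (\<lambda>v \<pi>. weight (blocks v \<pi> m q) + weight (?B v \<pi>) + 1)"
  proof (rule mean_mono)
    show "real (weight (blocks v \<pi> m (Suc q))) \<le> weight (blocks v \<pi> m q) + weight (?B v \<pi>) + 1" for v \<pi>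
      using weight_join_le[of "blocks v \<pi> m q" "?B v \<pi>"] unfolding blocks.simps by linarith
  qed
  also have "\<dots> = mean n (\<lambda>v \<pi>. weight (blocks v \<pi> m q)) + mean n (\<lambda>v \<pi>. weight (?B v \<pi>)) + 1"
    by (simp only: of_nat_add mean_add mean_const)
  also have "mean n (\<lambda>v \<pi>. weight (?B v \<pi>)) = mean n (\<lambda>v \<pi>. weight (block v (set (segment \<pi> 0 4))))"
    by (rule mean_segment[of "32 * m + 4 * q" 4 n "\<lambda>v xs. weight (block v (set xs))"]) (use Suc.prems in simp)
  also have "\<dots> = mean_weight n 0"
    by (simp add: mean_weight_def)
  finally show ?case using Suc by (simp add: algebra_simps)
qed simp

end

section \<open>The four-dimensional cube\<close>

lemma lessThan_unfold:
  "{..<8::nat} = {7, 6, 5, 4, 3, 2, 1, 0}"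
  "{..<15::nat} = {14, 13, 12, 11, 10, 9, 8, 7, 6, 5, 4, 3, 2, 1, 0}"
  "{..<16::nat} = {15, 14, 13, 12, 11, 10, 9, 8, 7, 6, 5, 4, 3, 2, 1, 0}"
  "{..<17::nat} = {16, 15, 14, 13, 12, 11, 10, 9, 8, 7, 6, 5, 4, 3, 2, 1, 0}"
  "{..<29::nat} = {28, 27, 26, 25, 24, 23, 22, 21, 20, 19, 18, 17, 16, 15, 14, 13, 12, 11, 10, 9, 8, 7, 6, 5, 4, 3, 2, 1, 0}"
  by (simp_all add: eval_nat_numeral lessThan_Suc)

lemma sum_less_4: "(\<Sum>i<4::nat. f i) = f 0 + f 1 + f 2 + (f 3 :: nat)"
  by (simp add: eval_nat_numeral)

text \<open>The propositional content of the bound for the four-dimensional cube. Vertices and subcubes of directions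
  are encoded as bit masks; \<open>E x i\<close> is the colour of the edge at \<open>x\<close> in direction \<open>i\<close>, \<open>R x S a k\<close> says
  that a walk from \<open>x\<close> along \<open>S\<close> starts with colour \<open>a\<close> and changes colour \<open>k\<close> times, \<open>P x y k\<close> that
  the blocks at the vertices from \<open>x\<close> to \<open>y - 1\<close> have total weight at least \<open>k\<close>, and \<open>Q x y k\<close> that
  at least \<open>k\<close> of these vertices are incident to two edges of either colour. The sums are split as
  in a balanced binary tree to keep the number of clauses small.\<close>

lemma cube4_sat:
  includes bit_operations_syntax
  fixes E :: "nat \<Rightarrow> nat \<Rightarrow> bool" and R :: "nat \<Rightarrow> nat \<Rightarrow> bool \<Rightarrow> nat \<Rightarrow> bool"
    and P Q :: "nat \<Rightarrow> nat \<Rightarrow> nat \<Rightarrow> bool"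
  assumes E: "\<And>x i. bit x i \<Longrightarrow> E x i = E (x - 2 ^ i) i"
    and base: "\<And>x i b. x < 8 \<Longrightarrow> i < 4 \<Longrightarrow> E x i = b \<Longrightarrow> R x (2 ^ i) b 0"
    and step: "\<And>x S i a b k. x < 8 \<Longrightarrow> 0 < S \<Longrightarrow> S < 16 \<Longrightarrow> i < 4 \<Longrightarrow> \<not> bit S i \<Longrightarrow>
      R x S a k \<Longrightarrow> E (x XOR S) i = b \<Longrightarrow> R x (S + 2 ^ i) a (k + of_bool (b \<noteq> (a \<noteq> odd k)))"
    and flex: "\<And>x k. x < 8 \<Longrightarrow> R x 15 True k \<Longrightarrow> R x 15 False k \<Longrightarrow> \<not> P x (Suc x) (2 * k + 1)"
    and fixd: "\<And>x a k. x < 8 \<Longrightarrow> R x 15 a k \<Longrightarrow> \<not> P x (Suc x) (2 * k + 2)"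
    and P_mono: "\<And>x y k. P x y (Suc k) \<Longrightarrow> P x y k"
    and P_max: "\<And>x k. x < 8 \<Longrightarrow> P x (Suc x) k \<Longrightarrow> P 0 1 k"
    and P_le: "\<And>x y k. 7 * (y - x) < k \<Longrightarrow> \<not> P x y k"
    and P_add: "\<And>x y z i j. x \<le> y \<Longrightarrow> y \<le> z \<Longrightarrow> P x z (i + j + 1) \<Longrightarrow> P x y (i + 1) \<or> P y z (j + 1)"
    and Q1: "\<And>x. x < 16 \<Longrightarrow> (\<Sum>i<4. of_bool (E x i)) = (2 :: nat) \<Longrightarrow> Q x (Suc x) 1"
    and Q0: "\<And>x y. Q x y 0"
    and Q_add: "\<And>x y z i j. x \<le> y \<Longrightarrow> y \<le> z \<Longrightarrow> Q x y i \<Longrightarrow> Q y z j \<Longrightarrow> Q x z (i + j)"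
    and PQ: "\<And>k. Q 0 16 k \<Longrightarrow> P 0 8 (17 + k div 2)"
    and r: "r \<le> 2" "\<And>i. i < 4 \<Longrightarrow> E 0 i = (i < r)"
  shows False
proof -
  \<comment> \<open>Names every edge by its end with bit \<open>i\<close> cleared, so that it
    becomes a single propositional atom.\<close>
  have E': "E (x XOR S) i = E (if bit (x XOR S) i then (x XOR S) - 2 ^ i else x XOR S) i" for x S i
    using E[of "x XOR S" i] by simp
  have all3: "(\<forall>x<3. f x) \<longleftrightarrow> f 2 \<and> f 1 \<and> f 0" for f :: "nat \<Rightarrow> bool"
    by (simp add: eval_nat_numeral All_less_Suc)
  have all4: "(\<forall>x<4. f x) \<longleftrightarrow> f 3 \<and> f 2 \<and> f 1 \<and> f 0" for f :: "nat \<Rightarrow> bool"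
    by (simp add: eval_nat_numeral All_less_Suc)
  have all7: "(\<forall>x<7. f x) \<longleftrightarrow> f 6 \<and> f 5 \<and> f 4 \<and> f 3 \<and> f 2 \<and> f 1 \<and> f 0" for f :: "nat \<Rightarrow> bool"
    by (simp add: eval_nat_numeral All_less_Suc)
  have all8: "(\<forall>x<8. f x) \<longleftrightarrow> f 7 \<and> f 6 \<and> f 5 \<and> f 4 \<and> f 3 \<and> f 2 \<and> f 1 \<and> f 0" for f :: "nat \<Rightarrow> bool"
    by (simp add: eval_nat_numeral All_less_Suc)
  note [simp] = numeral_2_eq_2 [symmetric] Q0 bit_Suc_0_iff
  note alls = all3 all4 all7 all8 all_bool_eq
  \<comment> \<open>Writing \<open>x XOR 0\<close> brings the colour into the form that
    \<open>E'\<close> rewrites.\<close>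
  have b: "\<forall>x<8. \<forall>i<4. \<forall>b. E (x XOR 0) i = b \<longrightarrow> R x (2 ^ i) b 0"
    using base by simp
  note b = b[unfolded E' alls, simplified]
  \<comment> \<open>The last colour is not stored: after \<open>k\<close> changes from
    \<open>a\<close> it is \<open>a \<noteq> odd k\<close>. The ranges of \<open>k\<close> here and
    below reflect that a walk along \<open>j\<close> edges changes colour at most
    \<open>j - 1\<close> times.\<close>
  have s1: "\<forall>x<8. \<forall>S\<in>{1,2,4,8}. \<forall>i<4. \<not> bit S i \<longrightarrow> (\<forall>k\<in>{0}. \<forall>a b. R x S a k \<longrightarrow> E (x XOR S) i = b \<longrightarrow>
      R x (S + 2 ^ i) a (k + of_bool (b \<noteq> (a \<noteq> odd k))))"
    by (intro ballI allI impI, rule step) auto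
  note s1 = s1[unfolded E' alls, simplified]
  have s2: "\<forall>x<8. \<forall>S\<in>{3,5,6,9,10,12}. \<forall>i<4. \<not> bit S i \<longrightarrow> (\<forall>k\<in>{0,1}. \<forall>a b. R x S a k \<longrightarrow> E (x XOR S) i = b \<longrightarrow>
      R x (S + 2 ^ i) a (k + of_bool (b \<noteq> (a \<noteq> odd k))))"
    by (intro ballI allI impI, rule step) auto
  note s2 = s2[unfolded E' alls, simplified]
  have s3: "\<forall>x<8. \<forall>S\<in>{7,11,13,14}. \<forall>i<4. \<not> bit S i \<longrightarrow> (\<forall>k\<in>{0,1,2}. \<forall>a b. R x S a k \<longrightarrow> E (x XOR S) i = b \<longrightarrow>
      R x (S + 2 ^ i) a (k + of_bool (b \<noteq> (a \<noteq> odd k))))"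
    by (intro ballI allI impI, rule step) auto
  note s3 = s3[unfolded E' alls, simplified]
  have f: "\<forall>x<8. \<forall>k<3. R x 15 True k \<longrightarrow> R x 15 False k \<longrightarrow> \<not> P x (Suc x) (2 * k + 1)"
    using flex by blast
  note f = f[unfolded alls, simplified]
  have x: "\<forall>x<8. \<forall>k<3. \<forall>a. R x 15 a k \<longrightarrow> \<not> P x (Suc x) (2 * k + 2)"
    using fixd by blast
  note x = x[unfolded alls, simplified]
  have pm: "\<forall>x<8. \<forall>k<7. P x (Suc x) (Suc k) \<longrightarrow> P x (Suc x) k"
    by (intro allI impI) (rule P_mono)
  note pm = pm[unfolded alls, simplified]
  have px: "\<forall>x<8. \<forall>k<8. P x (Suc x) k \<longrightarrow> P 0 1 k"
    using P_max by blast
  note px = px[unfolded alls, simplified]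
  have p2: "\<forall>x\<in>{0,2,4,6}. \<forall>i\<in>{..<8}. \<forall>j\<in>{..<8}. P x (x+2) (i + j + 1) \<longrightarrow> P x (Suc x) (i + 1) \<or> P (Suc x) (x+2) (j + 1)"
    by (intro ballI impI P_add) auto
  note p2 = p2[unfolded lessThan_unfold, simplified]
  have p4: "\<forall>x\<in>{0,4}. \<forall>i\<in>{..<15}. \<forall>j\<in>{..<15}. P x (x+4) (i + j + 1) \<longrightarrow> P x (x+2) (i + 1) \<or> P (x+2) (x+4) (j + 1)"
    by (intro ballI impI P_add) auto
  note p4 = p4[unfolded lessThan_unfold, simplified]
  \<comment> \<open>Only the totals \<open>17 + k div 2\<close> with \<open>k \<le> 16\<close>
    occur, that is, those from 17 to 25.\<close>
  have p8: "\<forall>i\<in>{..<29}. \<forall>j\<in>{..<29}. 16 \<le> i + j \<longrightarrow> i + j \<le> 24 \<longrightarrow> P 0 8 (i + j + 1) \<longrightarrow> P 0 4 (i + 1) \<or> P 4 8 (j + 1)"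
    by (intro ballI impI P_add) auto
  note p8 = p8[unfolded lessThan_unfold, simplified]
  have pl: "\<forall>x\<in>{0,1,2,3,4,5,6,7}. \<not> P x (Suc x) 8" "\<forall>x\<in>{0,2,4,6}. \<not> P x (x+2) 15" "\<forall>x\<in>{0,4}. \<not> P x (x+4) 29"
    by (intro ballI P_le; auto)+
  note pl = pl[simplified]
  have pm2: "\<forall>x\<in>{0,2,4,6}. \<forall>k\<in>{..<15}. P x (x+2) (Suc k) \<longrightarrow> P x (x+2) k"
    "\<forall>x\<in>{0,4}. \<forall>k\<in>{..<29}. P x (x+4) (Suc k) \<longrightarrow> P x (x+4) k"
    "\<forall>k\<in>{17,18,19,20,21,22,23,24}. P 0 8 (Suc k) \<longrightarrow> P 0 8 k"
    by (intro ballI impI, rule P_mono, assumption)+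
  note pm2 = pm2[unfolded lessThan_unfold, simplified]
  have q1: "\<forall>x\<in>{..<16}. (E (x XOR 0) 0 \<longrightarrow> E (x XOR 0) 1 \<longrightarrow> \<not> E (x XOR 0) 2 \<longrightarrow> \<not> E (x XOR 0) 3 \<longrightarrow> Q x (Suc x) 1) \<and>
     (E (x XOR 0) 0 \<longrightarrow> \<not> E (x XOR 0) 1 \<longrightarrow> E (x XOR 0) 2 \<longrightarrow> \<not> E (x XOR 0) 3 \<longrightarrow> Q x (Suc x) 1) \<and>
     (E (x XOR 0) 0 \<longrightarrow> \<not> E (x XOR 0) 1 \<longrightarrow> \<not> E (x XOR 0) 2 \<longrightarrow> E (x XOR 0) 3 \<longrightarrow> Q x (Suc x) 1) \<and>
     (\<not> E (x XOR 0) 0 \<longrightarrow> E (x XOR 0) 1 \<longrightarrow> E (x XOR 0) 2 \<longrightarrow> \<not> E (x XOR 0) 3 \<longrightarrow> Q x (Suc x) 1) \<and>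
     (\<not> E (x XOR 0) 0 \<longrightarrow> E (x XOR 0) 1 \<longrightarrow> \<not> E (x XOR 0) 2 \<longrightarrow> E (x XOR 0) 3 \<longrightarrow> Q x (Suc x) 1) \<and>
     (\<not> E (x XOR 0) 0 \<longrightarrow> \<not> E (x XOR 0) 1 \<longrightarrow> E (x XOR 0) 2 \<longrightarrow> E (x XOR 0) 3 \<longrightarrow> Q x (Suc x) 1)"
    by (intro ballI conjI impI Q1) (auto simp: sum_less_4)
  note q1 = q1[unfolded E' lessThan_unfold, simplified]
  have q2: "\<forall>x\<in>{0,2,4,6,8,10,12,14}. \<forall>i\<in>{0,1}. \<forall>j\<in>{0,1}. Q x (Suc x) i \<longrightarrow> Q (Suc x) (x+2) j \<longrightarrow> Q x (x+2) (i + j)"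
    "\<forall>x\<in>{0,4,8,12}. \<forall>i\<in>{0,1,2}. \<forall>j\<in>{0,1,2}. Q x (x+2) i \<longrightarrow> Q (x+2) (x+4) j \<longrightarrow> Q x (x+4) (i + j)"
    "\<forall>x\<in>{0,8}. \<forall>i\<in>{0,1,2,3,4}. \<forall>j\<in>{0,1,2,3,4}. Q x (x+4) i \<longrightarrow> Q (x+4) (x+8) j \<longrightarrow> Q x (x+8) (i + j)"
    "\<forall>i\<in>{0,1,2,3,4,5,6,7,8}. \<forall>j\<in>{0,1,2,3,4,5,6,7,8}. Q 0 8 i \<longrightarrow> Q 8 16 j \<longrightarrow> Q 0 16 (i + j)"
    by (intro ballI impI Q_add; auto)+
  note q2 = q2[simplified]
  have pq: "\<forall>k\<in>{..<17}. Q 0 16 k \<longrightarrow> P 0 8 (17 + k div 2)"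
    using PQ by blast
  note pq = pq[unfolded lessThan_unfold, simplified]
  \<comment> \<open>Symmetry is broken at vertex 0: it has a heaviest block by \<open>P_max\<close>,
    \<open>True\<close> is a colour of at most two of its edges, and these edges come first. Three
    patterns remain.\<close>
  have "r = 0 \<or> r = 1 \<or> r = 2" using r(1) by auto
  then show False
  proof (elim disjE)
    assume r0: "r = 0"
    have "\<forall>i\<in>{0,1,2,3}. E 0 i = (i < 0)" using r(2) unfolding r0 by simp
    note this[simplified]
    with b s1 s2 s3 f x pm px p2 p4 p8 pl pm2 q1 q2 pq show False by sat
  next
    assume r0: "r = 1"
    have "\<forall>i\<in>{0,1,2,3}. E 0 i = (i < 1)" using r(2) unfolding r0 by simp
    note this[simplified]
    with b s1 s2 s3 f x pm px p2 p4 p8 pl pm2 q1 q2 pq show False by sat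
  next
    assume r0: "r = 2"
    have "\<forall>i\<in>{0,1,2,3}. E 0 i = (i < 2)" using r(2) unfolding r0 by simp
    note this[simplified]
    with b s1 s2 s3 f x pm px p2 p4 p8 pl pm2 q1 q2 pq show False by sat
  qed
qed

lemma bit_minus_power:
  assumes "bit (x::nat) i"
  shows "bit (x - 2 ^ i) j \<longleftrightarrow> bit x j \<and> j \<noteq> i"
proof -
  have "set_bit i (unset_bit i x) = x"
    using assms by (auto intro!: bit_eqI simp: bit_set_bit_iff bit_unset_bit_iff)
  then have "x = unset_bit i x + 2 ^ i"
    by (simp add: set_bit_eq bit_unset_bit_iff)
  then have "x - 2 ^ i = unset_bit i x" by simp
  then show ?thesis by (auto simp: bit_unset_bit_iff)
qed

lemma bit_plus_power:
  assumes "\<not> bit (x::nat) i"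
  shows "bit (x + 2 ^ i) j \<longleftrightarrow> bit x j \<or> j = i"
proof -
  have "x + 2 ^ i = set_bit i x" using assms by (simp add: set_bit_eq)
  then show ?thesis by (auto simp: bit_set_bit_iff)
qed

context cube_colouring
begin

definition balanced :: "nat set \<Rightarrow> nat set \<Rightarrow> bool" where
  "balanced v S \<longleftrightarrow> card {i \<in> S. col v i} = 2"

text \<open>Each antipodal pair is counted twice, and weights are half changes, so this is four
  times the bound \<open>8 + b / 4\<close>. A counterexample is brought into the normal form refuted
  by \<open>cube4_sat\<close>.\<close>

lemma cube4:
  includes bit_operations_syntax
  assumes S: "card S = 4"
  shows "(\<Sum>T\<in>Pow S. weight (block (v \<oplus> T) S)) \<le> 32 + (\<Sum>T\<in>Pow S. of_bool (balanced (v \<oplus> T) S))"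
proof (rule ccontr)
  assume "\<not> ?thesis"
  then have less: "32 + (\<Sum>T\<in>Pow S. of_bool (balanced (v \<oplus> T) S)) < (\<Sum>T\<in>Pow S. weight (block (v \<oplus> T) S))"
    by (rule not_le_imp_less)
  have fin: "finite S" "S \<noteq> {}" using S card.infinite[of S] by force+
  let ?f = "\<lambda>T. weight (block (v \<oplus> T) S)"
  have img: "finite (?f ` Pow S)" "?f ` Pow S \<noteq> {}" using fin(1) by auto
  \<comment> \<open>Moving the origin to a vertex with a heaviest block uses up the translations of
    the subcube.\<close>
  from Max_in[OF img] obtain T0 where "Max (?f ` Pow S) = ?f T0" and "T0 \<in> Pow S" by (rule imageE)
  then have max: "?f T \<le> ?f T0" if "T \<in> Pow S" for T
    using Max_ge[OF img(1) imageI[OF that]] by simp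
  define u where "u = v \<oplus> T0"
  have sum_u: "(\<Sum>T\<in>Pow S. f (v \<oplus> T)) = (\<Sum>T\<in>Pow S. f (u \<oplus> T))" for f :: "nat set \<Rightarrow> nat"
  proof -
    have "u \<oplus> T = v \<oplus> (T \<oplus> T0)" for T
      by (simp add: u_def flip_assoc flip_commute[of T0])
    then show ?thesis
      using sum.reindex_bij_betw[OF bij_betw_flip, of T0 S "\<lambda>T. f (v \<oplus> T)"] \<open>T0 \<in> Pow S\<close> by simp
  qed
  define A where "A = {i \<in> S. col u i}"
  have card_A: "card A + card (S - A) = 4"
    using S fin(1) card_Un_disjoint[of A "S - A"] by (simp add: A_def Un_absorb2 Collect_conj_eq)
  \<comment> \<open>\<open>B\<close> consists of the directions at \<open>u\<close> whose colour
    occurs at most twice, and \<open>cc\<close> is the other colour. Comparing every colour with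
    \<open>cc\<close> renames the colour on \<open>B\<close> to \<open>True\<close>.\<close>
  obtain cc B where B: "B \<subseteq> S" "card B \<le> 2" "\<And>i. i \<in> S \<Longrightarrow> i \<in> B \<longleftrightarrow> (col u i \<noteq> cc)"
  proof (cases "card A \<le> 2")
    case True
    then show ?thesis by (intro that[of A False]) (auto simp: A_def)
  next
    case False
    with card_A show ?thesis by (intro that[of "S - A" True]) (auto simp: A_def)
  qed
  have fB: "finite B" "finite (S - B)" using B(1) fin(1) finite_subset by auto
  \<comment> \<open>Listing \<open>B\<close> first turns the pattern at \<open>u\<close> into
    \<open>i < card B\<close>.\<close>
  define ds where "ds = sorted_list_of_set B @ sorted_list_of_set (S - B)"
  have ds: "distinct ds" "set ds = S" using fB B(1) by (auto simp: ds_def)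
  have len: "length ds = 4" using distinct_card[OF ds(1)] ds(2) S by simp
  have ds_S: "ds ! i \<in> S" if "i < 4" for i using that len ds(2) nth_mem by metis
  have ds_B: "ds ! i \<in> B \<longleftrightarrow> i < card B" if "i < 4" for i
  proof (cases "i < card B")
    case True
    then have "ds ! i = sorted_list_of_set B ! i" using fB by (simp add: ds_def nth_append)
    moreover have "sorted_list_of_set B ! i \<in> set (sorted_list_of_set B)" using True fB by (intro nth_mem) simp
    ultimately show ?thesis using True fB by simp
  next
    case False
    then have i: "i - card B < length (sorted_list_of_set (S - B))"
      using that len fB unfolding ds_def by simp
    have "ds ! i = sorted_list_of_set (S - B) ! (i - card B)"
      using False fB by (simp add: ds_def nth_append)
    with nth_mem[OF i] False fB show ?thesis by simp
  qed
  have ds_inj: "ds ! i = ds ! j \<longleftrightarrow> i = j" if "i < 4" "j < 4" for i j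
    using that len ds(1) by (simp add: nth_eq_iff_index_eq)
  define emb where "emb x = {ds ! i | i. i < 4 \<and> bit x i}" for x :: nat
  have emb: "ds ! i \<in> emb x \<longleftrightarrow> bit x i" if "i < 4" for i x
    using that ds_inj by (auto simp: emb_def)
  have emb_S: "emb x \<subseteq> S" for x using ds_S by (auto simp: emb_def)
  have emb_eqI: "emb x = T" if "T \<subseteq> S" "\<And>i. i < 4 \<Longrightarrow> bit x i \<longleftrightarrow> ds ! i \<in> T" for x T
  proof -
    have "d \<in> emb x \<longleftrightarrow> d \<in> T" if "d \<in> S" for d
    proof -
      from that obtain i where "i < 4" "d = ds ! i" using ds(2) len by (metis in_set_conv_nth)
      then show ?thesis using emb \<open>\<And>i. i < 4 \<Longrightarrow> bit x i \<longleftrightarrow> ds ! i \<in> T\<close> by simp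
    qed
    then show ?thesis using emb_S[of x] that(1) by blast
  qed
  have emb_xor: "emb (x XOR y) = emb x \<oplus> emb y" for x y
    by (rule emb_eqI) (use emb_S[THEN subsetD] in \<open>auto simp: flip_def bit_xor_iff emb\<close>)
  have emb_power: "emb (2 ^ i) = {ds ! i}" if "i < 4" for i
    by (rule emb_eqI) (use that ds_S ds_inj in \<open>auto simp: bit_exp_iff\<close>)
  have emb_plus: "emb (x + 2 ^ i) = emb x \<union> {ds ! i}" if "i < 4" "\<not> bit x i" for x i
    by (rule emb_eqI) (use that ds_S ds_inj emb_S[THEN subsetD] in \<open>auto simp: bit_plus_power emb\<close>)
  have emb_minus: "emb x = emb (x - 2 ^ i) \<oplus> {ds ! i}" if "i < 4" "bit x i" for x i
    by (rule emb_eqI) (use that ds_S ds_inj emb_S[THEN subsetD] in \<open>auto simp: bit_minus_power emb flip_def\<close>)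
  have emb_15: "emb 15 = S"
  proof (rule emb_eqI)
    fix i :: nat assume "i < 4"
    then have "i = 0 \<or> i = 1 \<or> i = 2 \<or> i = 3" by auto
    then show "bit (15::nat) i \<longleftrightarrow> ds ! i \<in> S" using ds_S[OF \<open>i < 4\<close>] by (auto simp: bit_Suc_0_iff)
  qed simp
  have emb_0: "emb 0 = {}" by (simp add: emb_def)
  have inj: "inj_on emb {..<16}"
  proof (rule inj_onI)
    fix x y :: nat assume xy: "x \<in> {..<16}" "y \<in> {..<16}" "emb x = emb y"
    have "take_bit 4 x = x" "take_bit 4 y = y" using xy by (simp_all add: take_bit_nat_eq_self)
    moreover have "take_bit 4 x = take_bit 4 y"
      by (rule bit_eqI) (use emb[of _ x] emb[of _ y] xy(3) in \<open>auto simp: bit_take_bit_iff\<close>)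
    ultimately show "x = y" by metis
  qed
  have "emb ` {..<16} = Pow S"
    using emb_S fin(1) S by (intro card_subset_eq) (auto simp: card_image[OF inj] card_Pow)
  then have sum_emb: "(\<Sum>T\<in>Pow S. f T) = (\<Sum>x<16. f (emb x))" for f :: "nat set \<Rightarrow> nat"
    using sum.reindex[OF inj, of f] by simp
  define w where "w x = weight (block (u \<oplus> emb x) S)" for x
  define h where "h x = (of_bool (balanced (u \<oplus> emb x) S) :: nat)" for x
  define E where "E x i \<longleftrightarrow> i < 4 \<and> (col (u \<oplus> emb x) (ds ! i) \<noteq> cc)" for x i
  define R where "R x T a k \<longleftrightarrow> walk (u \<oplus> emb x) (emb T) (a \<noteq> cc) ((a \<noteq> odd k) \<noteq> cc) k" for x T a k
  define P where "P x y k \<longleftrightarrow> k \<le> (\<Sum>z = x..<y. w z)" for x y k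
  define Q where "Q x y k \<longleftrightarrow> k \<le> (\<Sum>z = x..<y. h z)" for x y k
  have w_less: "w x \<le> 7" for x
    using weight_block_less[OF fin, of "u \<oplus> emb x"] S by (simp add: w_def)
  have w_le_0: "w x \<le> w 0" for x
  proof -
    have "u \<oplus> emb x = v \<oplus> (emb x \<oplus> T0)" by (simp add: u_def flip_assoc flip_commute[of T0])
    moreover have "emb x \<oplus> T0 \<in> Pow S" using emb_S[of x] \<open>T0 \<in> Pow S\<close> by (auto simp: flip_def)
    ultimately show ?thesis using max by (simp add: w_def emb_0 u_def)
  qed
  have w_xor: "w (x XOR 15) = w x" for x
    using weight_block_flip[OF fin, of "u \<oplus> emb x"] by (simp add: w_def emb_xor emb_15 flip_assoc)
  have walk_S: "walk (u \<oplus> emb x) S (a \<noteq> cc) ((a \<noteq> odd k) \<noteq> cc) k" if "R x 15 a k" for x a k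
    using that unfolding R_def emb_15 .
  show False
  proof (rule cube4_sat[of E R P Q "card B"])
    show "E x i = E (x - 2 ^ i) i" if "bit x i" for x i
    proof (cases "i < 4")
      case True
      have "u \<oplus> emb x = u \<oplus> emb (x - 2 ^ i) \<oplus> {ds ! i}"
        by (simp add: emb_minus[OF True that] flip_assoc)
      then show ?thesis by (simp add: E_def)
    qed (simp add: E_def)
    show "R x (2 ^ i) b 0" if "i < 4" "E x i = b" for x i b
    proof -
      have "col (u \<oplus> emb x) (ds ! i) = (b \<noteq> cc)" using that by (auto simp: E_def)
      with walk_single[of "u \<oplus> emb x" "ds ! i"] show ?thesis
        by (simp add: R_def emb_power[OF that(1)])
    qed
    show "R x (T + 2 ^ i) a (k + of_bool (b \<noteq> (a \<noteq> odd k)))"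
      if "i < 4" "\<not> bit T i" "R x T a k" "E (x XOR T) i = b" for x T i a b k
    proof -
      have c: "col (u \<oplus> emb x \<oplus> emb T) (ds ! i) = (b \<noteq> cc)"
        using that(1,4) by (auto simp: E_def emb_xor flip_assoc)
      have disj: "emb T \<inter> {ds ! i} = {}" using emb[OF that(1)] that(2) by simp
      have single: "walk (u \<oplus> emb x \<oplus> emb T) {ds ! i} (b \<noteq> cc) (b \<noteq> cc) 0"
        using walk_single[of "u \<oplus> emb x \<oplus> emb T" "ds ! i"] unfolding c .
      have "walk (u \<oplus> emb x) (emb T \<union> {ds ! i}) (a \<noteq> cc) (b \<noteq> cc) (k + 0 + of_bool (((a \<noteq> odd k) \<noteq> cc) \<noteq> (b \<noteq> cc)))"
        by (rule walk_join[OF that(3)[unfolded R_def] single disj])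
      moreover have "((a \<noteq> odd (k + of_bool (b \<noteq> (a \<noteq> odd k)))) \<noteq> cc) = (b \<noteq> cc)" by auto
      moreover have "(((a \<noteq> odd k) \<noteq> cc) \<noteq> (b \<noteq> cc)) = (b \<noteq> (a \<noteq> odd k))" by auto
      ultimately show ?thesis
        unfolding R_def emb_plus[OF that(1,2)] by (simp only: add_0_right)
    qed
    show "\<not> P x (Suc x) (2 * k + 1)" if "R x 15 True k" "R x 15 False k" for x k
    proof -
      have "walk (u \<oplus> emb x) S a (a \<noteq> odd k) k" for a
        using walk_S[OF that(1)] walk_S[OF that(2)] by (cases a; cases cc) auto
      then have "realises (u \<oplus> emb x) S (Flexible (odd k) k)" by simp
      from weight_block_le[OF fin this] show ?thesis by (simp add: P_def w_def)
    qed
    show "\<not> P x (Suc x) (2 * k + 2)" if "R x 15 a k" for x a k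
    proof -
      have "realises (u \<oplus> emb x) S (Fixed (a \<noteq> cc) ((a \<noteq> odd k) \<noteq> cc) k)"
        using walk_S[OF that] by simp
      from weight_block_le[OF fin this] show ?thesis by (simp add: P_def w_def)
    qed
    show "P 0 1 k" if "P x (Suc x) k" for x k
      using that w_le_0[of x] by (simp add: P_def)
    show "\<not> P x y k" if "7 * (y - x) < k" for x y k
    proof -
      have "(\<Sum>z = x..<y. w z) \<le> of_nat (card {x..<y}) * 7" by (intro sum_bounded_above w_less)
      with that show ?thesis by (simp add: P_def)
    qed
    show "P x y (i + 1) \<or> P y z (j + 1)" if "x \<le> y" "y \<le> z" "P x z (i + j + 1)" for x y z i j
      using that sum.atLeastLessThan_concat[OF that(1,2), of w] by (auto simp: P_def)
    show "Q x z (i + j)" if "x \<le> y" "y \<le> z" "Q x y i" "Q y z j" for x y z i j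
      using that sum.atLeastLessThan_concat[OF that(1,2), of h] by (auto simp: Q_def)
    show "Q x (Suc x) 1" if "(\<Sum>i<4. of_bool (E x i)) = (2 :: nat)" for x
    proof -
      let ?C = "{d \<in> S. col (u \<oplus> emb x) d}"
      have "inj_on ((!) ds) {..<4}" using ds_inj by (auto intro: inj_onI)
      moreover have "(!) ds ` {..<4} = S" using len ds(2) by (auto simp: set_conv_nth)
      ultimately have "(\<Sum>d\<in>S. of_bool (col (u \<oplus> emb x) d \<noteq> cc)) = (\<Sum>i<4. of_bool (E x i) :: nat)"
        using sum.reindex[of "(!) ds" "{..<4}" "\<lambda>d. of_bool (col (u \<oplus> emb x) d \<noteq> cc) :: nat"]
        by (simp add: E_def)
      with that have 2: "card {d \<in> S. col (u \<oplus> emb x) d \<noteq> cc} = 2"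
        using fin(1) by (simp add: sum.If_cases of_bool_def Int_def)
      have "card ?C = 2"
      proof (cases cc)
        case True
        then have "{d \<in> S. col (u \<oplus> emb x) d \<noteq> cc} = S - ?C" by auto
        with 2 have "card (S - ?C) = 2" by simp
        then show ?thesis using S fin(1) card_Diff_subset[of ?C S] by simp
      qed (use 2 in simp)
      then show ?thesis by (simp add: Q_def h_def balanced_def)
    qed
    \<comment> \<open>Let \<open>W\<close> be the sum over one vertex from each antipodal pair. With
      \<open>k\<close> balanced vertices the negated claim reads \<open>33 + k \<le> 2 * W\<close>,
      and half of the left side, rounded up, is \<open>17 + k div 2\<close>.\<close>
    show "P 0 8 (17 + k div 2)" if "Q 0 16 k" for k
    proof -
      have "(\<Sum>x<16. w x) = 2 * (\<Sum>z = 0..<8. w z)"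
        using w_xor[of 0] w_xor[of 1] w_xor[of 2] w_xor[of 3] w_xor[of 4] w_xor[of 5] w_xor[of 6] w_xor[of 7]
        by (simp add: lessThan_nat_numeral atLeast0LessThan)
      moreover have "32 + (\<Sum>x<16. h x) < (\<Sum>x<16. w x)"
        using less unfolding sum_u[of "\<lambda>v. of_bool (balanced v S)"] sum_u[of "\<lambda>v. weight (block v S)"] sum_emb
        by (simp add: w_def h_def)
      moreover have "k \<le> (\<Sum>x<16. h x)" using that by (simp add: Q_def atLeast0LessThan)
      ultimately show ?thesis unfolding P_def by linarith
    qed
    show "E 0 i = (i < card B)" if "i < 4" for i
      using that ds_B[OF that] B(3)[OF ds_S[OF that]] by (simp add: E_def emb_0)
  qed (use B(2) in \<open>auto simp: P_def Q_def\<close>)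
qed

end

section \<open>The mean weight of a block\<close>

text \<open>The assumption says that \<open>f\<close> is 0 or 1 everywhere; with \<open>r\<close>
  ones there are \<open>r * (r - 1)\<close> ordered pairs of distinct ones.\<close>

lemma sum_distinct_pairs:
  fixes f :: "nat \<Rightarrow> real"
  assumes "\<And>i. f i * f i = f i"
  shows "(\<Sum>i<n. \<Sum>j<n. of_bool (i \<noteq> j) * (f i * f j)) = (\<Sum>i<n. f i) * ((\<Sum>i<n. f i) - 1)"
proof -
  have "(\<Sum>j<n. of_bool (i \<noteq> j) * (f i * f j)) = f i * (\<Sum>j<n. f j) - f i" if "i < n" for i
  proof -
    have "(\<Sum>j<n. of_bool (i \<noteq> j) * (f i * f j)) = (\<Sum>j<n. f i * f j - (if i = j then f i * f i else 0))"
      by (intro sum.cong refl) auto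
    also have "\<dots> = f i * (\<Sum>j<n. f j) - f i"
      using that by (simp add: sum_subtractf assms flip: sum_distrib_left)
    finally show ?thesis .
  qed
  then have "(\<Sum>i<n. \<Sum>j<n. of_bool (i \<noteq> j) * (f i * f j)) = (\<Sum>i<n. f i * (\<Sum>j<n. f j) - f i)"
    by (intro sum.cong refl) simp
  then show ?thesis
    by (simp add: sum_subtractf right_diff_distrib flip: sum_distrib_right)
qed

lemma sum_of_bool_notin:
  assumes "finite A" "A \<subseteq> {..<n}"
  shows "(\<Sum>l<n. of_bool (l \<notin> A) :: real) = real n - real (card A)"
proof -
  have "(\<Sum>l<n. of_bool (l \<notin> A) :: real) = real (card ({..<n} - A))"
    by (simp add: sum.If_cases of_bool_def Diff_eq Compl_eq)
  also have "\<dots> = real n - real (card A)"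
    using assms card_mono[of "{..<n}" A] by (simp add: card_Diff_subset of_nat_diff)
  finally show ?thesis .
qed

lemma sum_distinct_quadruples:
  "(\<Sum>i<n. \<Sum>j<n. \<Sum>k<n. \<Sum>l<n. of_bool (distinct [i, j, k, l]) :: real)
    = real n * (real n - 1) * (real n - 2) * (real n - 3)"
proof -
  have "(\<Sum>l<n. of_bool (distinct [i, j, k, l]) :: real) = of_bool (distinct [i, j, k]) * (real n - 3)"
    if "i < n" "j < n" "k < n" for i j k
  proof (cases "distinct [i, j, k]")
    case True
    then have "(\<Sum>l<n. of_bool (distinct [i, j, k, l]) :: real) = (\<Sum>l<n. of_bool (l \<notin> {i, j, k}))"
      by (intro sum.cong refl) auto
    also have "\<dots> = real n - 3"
      using that True by (subst sum_of_bool_notin) auto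
    finally show ?thesis using True by simp
  qed auto
  moreover have "(\<Sum>k<n. of_bool (distinct [i, j, k]) :: real) = of_bool (i \<noteq> j) * (real n - 2)"
    if "i < n" "j < n" for i j
  proof (cases "i = j")
    case False
    then have "(\<Sum>k<n. of_bool (distinct [i, j, k]) :: real) = (\<Sum>k<n. of_bool (k \<notin> {i, j}))"
      by (intro sum.cong refl) auto
    also have "\<dots> = real n - 2"
      using that False by (subst sum_of_bool_notin) auto
    finally show ?thesis using False by simp
  qed auto
  moreover have "(\<Sum>j<n. of_bool (i \<noteq> j) :: real) = real n - 1" if "i < n" for i
  proof -
    have "(\<Sum>j<n. of_bool (i \<noteq> j) :: real) = (\<Sum>j<n. of_bool (j \<notin> {i}))"
      by (intro sum.cong refl) auto
    also have "\<dots> = real n - 1"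
      using that by (subst sum_of_bool_notin) auto
    finally show ?thesis .
  qed
  ultimately show ?thesis
    by (simp del: distinct.simps flip: sum_distrib_right)
qed

context cube_colouring
begin

text \<open>The 16 vertices are indexed by fixed sets of positions, and by \<open>mean_flip\<close>
  each of them has the same joint distribution with the subcube.\<close>

lemma mean_subcube:
  assumes "4 \<le> n"
  shows "16 * mean n (\<lambda>v \<pi>. f v (set (segment \<pi> 0 4)))
    = mean n (\<lambda>v \<pi>. \<Sum>T\<in>Pow (set (segment \<pi> 0 4)). f (v \<oplus> T) (set (segment \<pi> 0 4)))"
proof -
  have "mean n (\<lambda>v \<pi>. \<Sum>T\<in>Pow (set (segment \<pi> 0 4)). f (v \<oplus> T) (set (segment \<pi> 0 4)))
    = mean n (\<lambda>v \<pi>. \<Sum>A\<in>Pow {..<4}. f (v \<oplus> \<pi> ` A) (set (segment \<pi> 0 4)))"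
  proof (rule mean_cong)
    fix v \<pi> assume \<pi>: "\<pi> permutes {..<n}"
    have "inj_on ((`) \<pi>) (Pow {..<4})"
      by (intro inj_onI) (simp add: inj_image_eq_iff[OF permutes_inj[OF \<pi>]])
    moreover have "(`) \<pi> ` Pow {..<4} = Pow (set (segment \<pi> 0 4))"
      by (intro image_Pow_surj) (simp add: atLeast0LessThan)
    ultimately show "(\<Sum>T\<in>Pow (set (segment \<pi> 0 4)). f (v \<oplus> T) (set (segment \<pi> 0 4)))
      = (\<Sum>A\<in>Pow {..<4}. f (v \<oplus> \<pi> ` A) (set (segment \<pi> 0 4)))"
      using sum.reindex[of "(`) \<pi>" "Pow {..<4}" "\<lambda>T. f (v \<oplus> T) (set (segment \<pi> 0 4))"] by (simp only: comp_def)
  qed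
  also have "\<dots> = (\<Sum>A\<in>Pow {..<4}. mean n (\<lambda>v \<pi>. f (v \<oplus> \<pi> ` A) (set (segment \<pi> 0 4))))"
    by (rule mean_sum)
  also have "\<dots> = (\<Sum>A\<in>Pow {..<4::nat}. mean n (\<lambda>v \<pi>. f v (set (segment \<pi> 0 4))))"
  proof (intro sum.cong refl mean_flip[where f = "\<lambda>v \<pi>. f v (set (segment \<pi> 0 4))"])
    fix A \<pi> assume "A \<in> Pow {..<4::nat}" and \<pi>: "\<pi> permutes {..<n}"
    then have "A \<subseteq> {..<n}" using assms by auto
    then show "\<pi> ` A \<subseteq> {..<n}"
      using permutes_image[OF \<pi>] by (metis image_mono)
  qed
  finally show ?thesis by (simp add: card_Pow)
qed

lemma mean_weight_0_le:
  assumes "4 \<le> n"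
  shows "mean_weight n 0 \<le> 2 + mean n (\<lambda>v \<pi>. of_bool (balanced v (set (segment \<pi> 0 4))))"
proof -
  let ?S = "\<lambda>\<pi>. set (segment \<pi> 0 4)"
  have "16 * mean_weight n 0 = mean n (\<lambda>v \<pi>. \<Sum>T\<in>Pow (?S \<pi>). real (weight (block (v \<oplus> T) (?S \<pi>))))"
    using mean_subcube[OF assms, of "\<lambda>v S. real (weight (block v S))"] by (simp add: mean_weight_def)
  also have "\<dots> \<le> mean n (\<lambda>v \<pi>. 32 + (\<Sum>T\<in>Pow (?S \<pi>). of_bool (balanced (v \<oplus> T) (?S \<pi>))))"
  proof (rule mean_mono)
    fix v \<pi> assume \<pi>: "\<pi> permutes {..<n}"
    have "card (?S \<pi>) = 4"
      using distinct_card[OF segment_simps(1)[OF \<pi>], of 0 4] by simp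
    from of_nat_mono[OF cube4[OF this, of v], where 'a = real]
    show "(\<Sum>T\<in>Pow (?S \<pi>). real (weight (block (v \<oplus> T) (?S \<pi>))))
      \<le> 32 + (\<Sum>T\<in>Pow (?S \<pi>). of_bool (balanced (v \<oplus> T) (?S \<pi>)))"
      by (simp only: of_nat_add of_nat_sum of_nat_of_bool of_nat_numeral)
  qed
  also have "\<dots> = 32 + 16 * mean n (\<lambda>v \<pi>. of_bool (balanced v (?S \<pi>)))"
    using mean_subcube[OF assms, of "\<lambda>v S. of_bool (balanced v S)"] by (simp only: mean_add mean_const)
  finally show ?thesis by simp
qed

text \<open>Six patterns of two colours are balanced, all equally likely by exchangeability. If
  \<open>r\<close> edges at the vertex are \<open>True\<close>, one pattern is matched by
  \<open>r * (r - 1) * (n - r) * (n - r - 1)\<close> ordered quadruples, a product largest near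
  \<open>r = n / 2\<close>.\<close>

lemma mean_balanced_le:
  assumes "4 \<le> n"
  shows "mean n (\<lambda>v \<pi>. of_bool (balanced v (set (segment \<pi> 0 4))))
    \<le> 3 / 8 * (real n * (real n - 2)) / ((real n - 1) * (real n - 3))"
proof -
  define pat :: "nat set \<Rightarrow> nat list \<Rightarrow> real" where
    "pat v xs = of_bool (col v (xs ! 0) \<and> col v (xs ! 1) \<and> \<not> col v (xs ! 2) \<and> \<not> col v (xs ! 3))" for v xs
  define P where "P = mean n (\<lambda>v \<pi>. pat v (map \<pi> [0, 1, 2, 3]))"
  have P: "mean n (\<lambda>v \<pi>. pat v (map \<pi> [i, j, k, l])) = P"
    if "distinct [i, j, k, l]" "i < n" "j < n" "k < n" "l < n" for i j k l
    unfolding P_def using that assms by (intro mean_exchange[where f = pat]) auto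
  have "mean n (\<lambda>v \<pi>. of_bool (balanced v (set (segment \<pi> 0 4)))) = mean n (\<lambda>v \<pi>.
    pat v (map \<pi> [0, 1, 2, 3]) + pat v (map \<pi> [0, 2, 1, 3]) + pat v (map \<pi> [0, 3, 1, 2]) +
    pat v (map \<pi> [1, 2, 0, 3]) + pat v (map \<pi> [1, 3, 0, 2]) + pat v (map \<pi> [2, 3, 0, 1]))"
  proof (rule mean_cong)
    fix v \<pi> assume \<pi>: "\<pi> permutes {..<n}"
    have upt: "[0..<0 + 4] = [0, 1, 2, 3]" by (simp add: upt_rec)
    have dist: "distinct (map \<pi> [0, 1, 2, 3])"
      using segment_simps(1)[OF \<pi>, of 0 4] unfolding upt .
    have "card {i \<in> set (map \<pi> [0, 1, 2, 3]). col v i} = (\<Sum>i\<in>set (map \<pi> [0, 1, 2, 3]). of_bool (col v i))"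
      by (simp add: sum.If_cases of_bool_def Int_def)
    also have "\<dots> = of_bool (col v (\<pi> 0)) + of_bool (col v (\<pi> 1)) + of_bool (col v (\<pi> 2)) + of_bool (col v (\<pi> 3))"
      using dist by simp
    finally have card: "card {i \<in> set (map \<pi> [0, 1, 2, 3]). col v i} = \<dots>" .
    show "of_bool (balanced v (set (segment \<pi> 0 4))) =
      pat v (map \<pi> [0, 1, 2, 3]) + pat v (map \<pi> [0, 2, 1, 3]) + pat v (map \<pi> [0, 3, 1, 2]) +
      pat v (map \<pi> [1, 2, 0, 3]) + pat v (map \<pi> [1, 3, 0, 2]) + pat v (map \<pi> [2, 3, 0, 1])"
      unfolding upt balanced_def card pat_def
      by (cases "col v (\<pi> 0)"; cases "col v (\<pi> 1)"; cases "col v (\<pi> 2)"; cases "col v (\<pi> 3)") simp_all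
  qed
  also have "\<dots> = 6 * P"
    using P[of 0 1 2 3] P[of 0 2 1 3] P[of 0 3 1 2] P[of 1 2 0 3] P[of 1 3 0 2] P[of 2 3 0 1] assms
    by (simp add: mean_add)
  finally have six: "mean n (\<lambda>v \<pi>. of_bool (balanced v (set (segment \<pi> 0 4)))) = 6 * P" .
  let ?q = "\<lambda>v \<pi> i j k l. of_bool (distinct [i, j, k, l]) * pat v (map \<pi> [i, j, k, l])"
  \<comment> \<open>Summing over all quadruples of distinct positions replaces the probability
    \<open>P\<close> by a count for fixed \<open>v\<close> and \<open>\<pi>\<close>.\<close>
  have "mean n (\<lambda>v \<pi>. \<Sum>i<n. \<Sum>j<n. \<Sum>k<n. \<Sum>l<n. ?q v \<pi> i j k l)
    = (\<Sum>i<n. \<Sum>j<n. \<Sum>k<n. \<Sum>l<n. of_bool (distinct [i, j, k, l]) * mean n (\<lambda>v \<pi>. pat v (map \<pi> [i, j, k, l])))"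
    by (simp only: mean_sum mean_cmult)
  also have "\<dots> = (\<Sum>i<n. \<Sum>j<n. \<Sum>k<n. \<Sum>l<n. of_bool (distinct [i, j, k, l]) * P)"
    by (intro sum.cong refl) (use P in \<open>auto simp del: distinct.simps simp: of_bool_def\<close>)
  also have "\<dots> = real n * (real n - 1) * (real n - 2) * (real n - 3) * P"
    unfolding sum_distinct_quadruples[symmetric] sum_distrib_right ..
  finally have "real n * (real n - 1) * (real n - 2) * (real n - 3) * P
    = mean n (\<lambda>v \<pi>. \<Sum>i<n. \<Sum>j<n. \<Sum>k<n. \<Sum>l<n. ?q v \<pi> i j k l)" by simp
  also have "\<dots> \<le> mean n (\<lambda>v \<pi>. (real n)\<^sup>2 / 4 * ((real n - 2)\<^sup>2 / 4))"
  proof (rule mean_mono)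
    fix v and \<pi> :: "nat \<Rightarrow> nat"
    define C where "C i = (of_bool (col v (\<pi> i)) :: real)" for i
    define r where "r = (\<Sum>i<n. C i)"
    have CC: "C i * C i = C i" "(1 - C i) * (1 - C i) = 1 - C i" for i
      by (auto simp: C_def)
    have q: "?q v \<pi> i j k l = of_bool (i \<noteq> j) * (C i * C j) * (of_bool (k \<noteq> l) * ((1 - C k) * (1 - C l)))" for i j k l
      by (auto simp: C_def pat_def)
    have "(\<Sum>i<n. \<Sum>j<n. \<Sum>k<n. \<Sum>l<n. ?q v \<pi> i j k l)
      = (\<Sum>i<n. \<Sum>j<n. of_bool (i \<noteq> j) * (C i * C j)) * (\<Sum>k<n. \<Sum>l<n. of_bool (k \<noteq> l) * ((1 - C k) * (1 - C l)))"
      unfolding q sum_distrib_right unfolding sum_distrib_left by (rule refl)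
    also have "\<dots> = r * (r - 1) * ((real n - r) * (real n - r - 1))"
      unfolding sum_distinct_pairs[of C, OF CC(1)] sum_distinct_pairs[of "\<lambda>i. 1 - C i", OF CC(2)]
      by (simp add: sum_subtractf r_def)
    also have "\<dots> = (r * (real n - r)) * ((r - 1) * (real n - r - 1))"
      by (simp add: algebra_simps)
    \<comment> \<open>Each product is at most the square of half the sum of its two factors. The
      second one is treated first, because it may be negative while \<open>r * (real n - r)\<close>
      is not.\<close>
    also have "\<dots> \<le> (r * (real n - r)) * ((real n - 2)\<^sup>2 / 4)"
    proof (rule mult_left_mono)
      have "0 \<le> (2 * r - real n)\<^sup>2" by simp
      then show "(r - 1) * (real n - r - 1) \<le> (real n - 2)\<^sup>2 / 4"
        by (simp add: power2_eq_square algebra_simps)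
      have "0 \<le> r" unfolding r_def by (intro sum_nonneg) (simp add: C_def)
      moreover have "r \<le> (\<Sum>i<n. 1)" unfolding r_def by (intro sum_mono) (simp add: C_def)
      ultimately show "0 \<le> r * (real n - r)" by simp
    qed
    also have "\<dots> \<le> (real n)\<^sup>2 / 4 * ((real n - 2)\<^sup>2 / 4)"
    proof (rule mult_right_mono)
      have "0 \<le> (2 * r - real n)\<^sup>2" by simp
      then show "r * (real n - r) \<le> (real n)\<^sup>2 / 4"
        by (simp add: power2_eq_square algebra_simps)
    qed simp
    finally show "(\<Sum>i<n. \<Sum>j<n. \<Sum>k<n. \<Sum>l<n. ?q v \<pi> i j k l) \<le> (real n)\<^sup>2 / 4 * ((real n - 2)\<^sup>2 / 4)" .
  qed
  finally have "(real n * (real n - 2)) * ((real n - 1) * (real n - 3) * P) \<le> (real n * (real n - 2)) * (real n * (real n - 2) / 16)"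
    by (simp add: power2_eq_square mult_ac)
  then have "(real n - 1) * (real n - 3) * P \<le> real n * (real n - 2) / 16"
    using assms by (subst (asm) mult_le_cancel_left_pos) auto
  then have "6 * P * ((real n - 1) * (real n - 3)) \<le> 3 / 8 * (real n * (real n - 2))"
    by (simp add: algebra_simps)
  then show ?thesis
    unfolding six using assms by (subst pos_le_divide_eq) auto
qed

end

section \<open>Antipodal geodesics\<close>

context cube_colouring
begin

text \<open>The amount by which the bound in \<open>mean_balanced_le\<close> exceeds
  \<open>3 / 8\<close>; note \<open>n * (n - 2) - (n - 1) * (n - 3) = 2 * n - 3\<close>.\<close>

definition excess :: "nat \<Rightarrow> real" where
  "excess n = 3 / 8 * (2 * real n - 3) / ((real n - 1) * (real n - 3))"

lemma mean_weight_0: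
  assumes "4 \<le> n"
  shows "mean_weight n 0 \<le> 19 / 8 + excess n"
proof -
  have "(real n - 1) * (real n - 3) > 0" using assms by simp
  then have "3 / 8 * (real n * (real n - 2)) / ((real n - 1) * (real n - 3)) = 3 / 8 + excess n"
    unfolding excess_def by (simp add: field_simps)
  with mean_weight_0_le[OF assms] mean_balanced_le[OF assms] show ?thesis by linarith
qed

text \<open>At most \<open>n / 4\<close> blocks fit, and \<open>n / 4 * excess n\<close> decreases
  in \<open>n\<close>: it equals \<open>5 / 8\<close> at 4 and about 0.204 at 32.\<close>

lemma excess_bounds:
  assumes "4 \<le> n" "4 * x \<le> n"
  shows "real x * excess n \<le> 5 / 8" "32 \<le> n \<Longrightarrow> real x * excess n \<le> 21 / 100"
proof -
  define t where "t = real n"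
  have t: "4 \<le> t" "4 * real x \<le> t" using assms unfolding t_def by linarith+
  have pos: "(t - 1) * (t - 3) > 0" using t(1) by simp
  have ex: "excess n = 3 / 8 * (2 * t - 3) / ((t - 1) * (t - 3))"
    by (simp add: excess_def t_def)
  then have "0 \<le> excess n" using t(1) by simp
  with t(2) have "real x * excess n \<le> t / 4 * excess n"
    by (intro mult_right_mono) auto
  also have "t / 4 * excess n = 3 / 32 * (t * (2 * t - 3)) / ((t - 1) * (t - 3))"
    unfolding ex using pos by (simp add: field_simps)
  finally have x: "real x * excess n \<le> 3 / 32 * (t * (2 * t - 3)) / ((t - 1) * (t - 3))" .
  \<comment> \<open>This product is 32 times the difference of the two sides of the next
    inequality.\<close>
  have "0 \<le> (t - 4) * (14 * t - 15)" using t(1) by simp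
  then have "3 / 32 * (t * (2 * t - 3)) \<le> 5 / 8 * ((t - 1) * (t - 3))"
    by (simp add: algebra_simps)
  with pos have "3 / 32 * (t * (2 * t - 3)) / ((t - 1) * (t - 3)) \<le> 5 / 8"
    by (subst pos_divide_le_eq) auto
  with x show "real x * excess n \<le> 5 / 8" by linarith
  assume "32 \<le> n"
  then have "32 \<le> t" by (simp add: t_def)
  then have "0 \<le> (t - 32) * (24 * t + 172)" by simp
  then have "3 / 32 * (t * (2 * t - 3)) \<le> 21 / 100 * ((t - 1) * (t - 3))"
    using \<open>32 \<le> t\<close> by (simp add: algebra_simps)
  with pos have "3 / 32 * (t * (2 * t - 3)) / ((t - 1) * (t - 3)) \<le> 21 / 100"
    by (subst pos_divide_le_eq) auto
  with x show "real x * excess n \<le> 21 / 100" by linarith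
qed

lemma mean_weight_3:
  assumes "32 \<le> n"
  shows "mean_weight n 3 \<le> 8 * mean_weight n 0 + 4 / (real (n div 4) - 1)
    + 2 / (real (n div 8) - 1) + 1 / (real (n div 16) - 1)"
  using mean_weight_Suc[of 0 n] mean_weight_Suc[of 1 n] mean_weight_Suc[of 2 n] assms
  by (simp add: numeral_3_eq_3 numeral_2_eq_2)

lemma realises_imp_walk:
  assumes "realises v S g"
  shows "\<exists>a b k. walk v S a b k \<and> 2 * k \<le> weight g"
proof (cases g)
  case (Fixed a b k)
  with assms have "walk v S a b k \<and> 2 * k \<le> weight g" by simp
  then show ?thesis by blast
next
  case (Flexible t k)
  have "walk v S True (True \<noteq> t) k"
    using assms unfolding Flexible realises.simps by (rule spec)
  with Flexible show ?thesis by auto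
qed

text \<open>With \<open>n = 32 * m + 4 * q + r\<close>, the superblocks cost \<open>5 / 16\<close>
  per edge on average; the constant 6 absorbs the leftover edges and all error terms.\<close>

lemma ex_walk:
  "\<exists>v a b k. v \<subseteq> {..<n} \<and> walk v {..<n} a b k \<and> real k \<le> 5 / 16 * real n + 6"
proof -
  define m q r where "m = n div 32" and "q = n mod 32 div 4" and "r = n mod 32 mod 4"
  have "n mod 32 = 4 * q + r"
    unfolding q_def r_def by simp
  then have n: "n = 32 * m + 4 * q + r" unfolding m_def using mult_div_mod_eq[of 32 n] by simp
  have q: "q \<le> 7" unfolding q_def using mod_less_divisor[of 32 n] by simp
  have r: "r \<le> 3" unfolding r_def using mod_less_divisor[of 4 "n mod 32"] by simp
  obtain v \<pi> where v: "v \<subseteq> {..<n}" and \<pi>: "\<pi> permutes {..<n}"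
    and le: "real (weight (blocks v \<pi> m q)) \<le> mean n (\<lambda>v \<pi>. weight (blocks v \<pi> m q))"
    using ex_le_mean[of n "\<lambda>v \<pi>. weight (blocks v \<pi> m q)"] by blast
  define g where "g = edges v \<pi> m q r"
  have "realises v (\<pi> ` {..<n}) g"
    unfolding n g_def by (rule realises_edges[OF \<pi>])
  then have g: "realises v {..<n} g"
    by (simp add: permutes_image[OF \<pi>])
  have "mean n (\<lambda>v \<pi>. weight (blocks v \<pi> m q))
      \<le> mean n (\<lambda>v \<pi>. weight (supers v \<pi> m)) + real q * (mean_weight n 0 + 1)"
    by (rule mean_blocks) (simp add: n)
  with le weight_edges[of v \<pi> m q r]
  have weight: "real (weight g) \<le> mean n (\<lambda>v \<pi>. weight (supers v \<pi> m)) + real q * (mean_weight n 0 + 1) + 2 * real r"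
    unfolding g_def by linarith
  show ?thesis
  proof (cases "m = 0")
    case True
    have qW: "real q * mean_weight n 0 \<le> 19 / 8 * real q + 5 / 8"
    proof (cases "q = 0")
      case False
      then have "4 \<le> n" "4 * q \<le> n" using n by auto
      then have "real q * mean_weight n 0 \<le> real q * (19 / 8 + excess n)"
        by (intro mult_left_mono mean_weight_0) auto
      with excess_bounds(1)[OF \<open>4 \<le> n\<close> \<open>4 * q \<le> n\<close>] show ?thesis by (simp add: algebra_simps)
    qed simp
    have "real (weight g) \<le> real q * mean_weight n 0 + real q + 2 * real r"
      using weight True by (simp add: algebra_simps)
    with qW have w: "real (weight g) \<le> 27 / 8 * real q + 5 / 8 + 2 * real r" by linarith
    \<comment> \<open>Without superblocks the gadget may be flexible, so only
      \<open>2 * k \<le> weight g\<close> is available.\<close>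
    obtain a b k where k: "walk v {..<n} a b k" "2 * k \<le> weight g"
      using realises_imp_walk[OF g] by blast
    from k(2) w have "2 * real k \<le> 27 / 8 * real q + 5 / 8 + 2 * real r" by linarith
    moreover have "real n = 4 * real q + real r" using n True by simp
    moreover have "real q \<le> 7" "real r \<le> 3" using q r by auto
    ultimately have "real k \<le> 5 / 16 * real n + 6" by linarith
    with v k(1) show ?thesis by blast
  next
    case False
    then obtain m' where m': "m = Suc m'" by (cases m) auto
    have n32: "32 \<le> n" using n False by simp
    obtain a b k where gk: "g = Fixed a b k"
      using edges_Fixed[of m] False unfolding g_def by blast
    define E where "E = 4 / (real (n div 4) - 1) + 2 / (real (n div 8) - 1) + 1 / (real (n div 16) - 1)"
    have supers: "mean n (\<lambda>v \<pi>. weight (supers v \<pi> m)) \<le> real m * (mean_weight n 3 + 1) + real m' / (real m - 1)"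
    proof -
      have "32 * Suc m' \<le> n" using n unfolding m' by simp
      from mean_supers[OF this] show ?thesis
        unfolding m'[symmetric] m_def[symmetric] .
    qed
    have "real m * mean_weight n 3 \<le> real m * (8 * mean_weight n 0 + E)"
      using mean_weight_3[OF n32] unfolding E_def by (intro mult_left_mono) auto
    moreover have "4 * (8 * m + q) \<le> n" "4 \<le> n" using n n32 by auto
    then have "real (8 * m + q) * mean_weight n 0 \<le> real (8 * m + q) * (19 / 8 + excess n)"
      by (intro mult_left_mono mean_weight_0) auto
    then have "real (8 * m + q) * mean_weight n 0 \<le> 19 / 8 * real (8 * m + q) + 21 / 100"
      using excess_bounds(2)[OF \<open>4 \<le> n\<close> \<open>4 * (8 * m + q) \<le> n\<close> n32] by (simp add: algebra_simps)
    ultimately have w: "real (weight g) \<le> 20 * real m + real m * E + real m' / (real m - 1)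
        + 27 / 8 * real q + 21 / 100 + 2 * real r"
      using weight supers unfolding distrib_left of_nat_add of_nat_mult distrib_right by simp
    have wk: "real (weight g) = 2 * real k + 1" by (simp add: gk)
    have nr: "real n = 32 * real m + 4 * real q + real r" using n by simp
    have qr: "real q \<le> 7" "real r \<le> 3" using q r by auto
    have K: "n div 4 = 8 * m + q" "n div 8 = 4 * m + q div 2" "n div 16 = 2 * m + q div 4"
    proof -
      show n4: "n div 4 = 8 * m + q"
        by (rule div_nat_eqI; use n r in simp)
      have "(8 * m + q) div 2 = 4 * m + q div 2" "(8 * m + q) div 4 = 2 * m + q div 4"
        by presburger+
      with div_mult2_eq[of n 4 2] div_mult2_eq[of n 4 4]
      show "n div 8 = 4 * m + q div 2" "n div 16 = 2 * m + q div 4"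
        by (simp_all add: n4)
    qed
    \<comment> \<open>The right side is \<open>2 * 6 + 1\<close>, the last 1 coming from the fixed
      gadget. A leftover block exceeds the allowed \<open>5 / 8\<close> per edge by
      \<open>27 / 8 - 20 / 8\<close>, a leftover edge by \<open>2 - 5 / 8\<close>.\<close>
    have "real m * E + real m' / (real m - 1) + 7 / 8 * real q + 11 / 8 * real r + 21 / 100 \<le> 13"
    proof (cases "m = 1")
      \<comment> \<open>A single superblock has no junction with another one; accordingly the
        quotient is \<open>0 / 0 = 0\<close>.\<close>
      case True
      have "E \<le> 4 / 7 + 2 / 3 + 1 / 1"
        unfolding E_def K True by (intro add_mono divide_left_mono) auto
      with True qr show ?thesis unfolding m' by simp
    next
      case False
      with m' have m2: "2 \<le> real m" by simp
      then have m1: "real m' / (real m - 1) = 1" unfolding m' by simp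
      show ?thesis
      \<comment> \<open>The estimate used for \<open>q \<le> 6\<close> would exceed 13 at
        \<open>q = 7\<close>. There the exact quotients of \<open>n\<close> are larger and make each
        of the three terms of \<open>real m * E\<close> at most \<open>1 / 2\<close>.\<close>
      proof (cases "q = 7")
        case True
        have "real m * E = 4 * real m / (8 * real m + 6) + 2 * real m / (4 * real m + 2) + real m / (2 * real m)"
          unfolding E_def K True by (simp add: algebra_simps)
        also have "\<dots> \<le> 1 / 2 + 1 / 2 + 1 / 2"
          using m2 by (intro add_mono) (auto simp: field_simps)
        finally show ?thesis using m1 qr True by simp
      next
        case False
        then have q6: "real q \<le> 6" using q by simp
        have "E \<le> 4 / (8 * real m - 1) + 2 / (4 * real m - 1) + 1 / (2 * real m - 1)"
          unfolding E_def K using m2 by (intro add_mono divide_left_mono) auto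
        then have "real m * E \<le> real m * (4 / (8 * real m - 1) + 2 / (4 * real m - 1) + 1 / (2 * real m - 1))"
          by (intro mult_left_mono) auto
        also have "\<dots> = 4 * real m / (8 * real m - 1) + 2 * real m / (4 * real m - 1) + real m / (2 * real m - 1)"
          by (simp add: algebra_simps)
        also have "\<dots> \<le> 8 / 15 + 4 / 7 + 2 / 3"
          using m2 by (intro add_mono) (auto simp: field_simps)
        finally show ?thesis using m1 qr q6 by simp
      qed
    qed
    with w wk nr have "real k \<le> 5 / 16 * real n + 6" by linarith
    moreover have "walk v {..<n} a b k" using g gk by simp
    ultimately show ?thesis using v by blast
  qed
qed

end

section \<open>From sets of coordinates to Boolean lists\<close>

definition to_list :: "nat \<Rightarrow> nat set \<Rightarrow> bool list" where
  "to_list n v = map (\<lambda>i. i \<in> v) [0..<n]"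

lemma to_list_simps [simp]: "length (to_list n v) = n" "i < n \<Longrightarrow> to_list n v ! i \<longleftrightarrow> i \<in> v"
  by (auto simp: to_list_def)

lemma to_list_eqD: "to_list n v = to_list n w \<Longrightarrow> i < n \<Longrightarrow> i \<in> v \<longleftrightarrow> i \<in> w"
  using to_list_simps(2)[of i n v] to_list_simps(2)[of i n w] by simp

lemma cube_edge:
  assumes "i < n"
  shows "{to_list n v, to_list n (v \<oplus> {i})} \<in> cube_edges n"
proof -
  have "{j. j < n \<and> to_list n v ! j \<noteq> to_list n (v \<oplus> {i}) ! j} = {i}"
    using assms by (auto simp: flip_def)
  then show ?thesis
    unfolding cube_edges_def cube_vertices_def
    by (intro CollectI exI[of _ "to_list n v"] exI[of _ "to_list n (v \<oplus> {i})"]) simp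
qed

context cube_colouring
begin

text \<open>\<open>cost\<close> counts the changes at inner vertices and, in addition, those against
  the outer colours.\<close>

lemma changes_le_cost:
  assumes "distinct xs"
  shows "card {k. 0 < k \<and> k < length xs \<and>
    col (v \<oplus> set (take (k - 1) xs)) (xs ! (k - 1)) \<noteq> col (v \<oplus> set (take k xs)) (xs ! k)} \<le> cost v a xs b"
  using assms
proof (induction xs arbitrary: v a)
  case (Cons x xs)
  define C where "C v xs k = col (v \<oplus> set (take k xs)) (xs ! k)" for v xs k
  define D where "D v xs = {k. 0 < k \<and> k < length xs \<and> C v xs (k - 1) \<noteq> C v xs k}" for v xs
  have IH: "card (D (v \<oplus> {x}) xs) \<le> cost (v \<oplus> {x}) c xs b" for c
    using Cons by (simp add: C_def D_def)
  have C_Suc: "C v (x # xs) (Suc k) = C (v \<oplus> {x}) xs k" for k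
  proof -
    have "x \<notin> set (take k xs)" using Cons.prems by (auto dest: in_set_takeD)
    then show ?thesis by (simp add: C_def flip_insert)
  qed
  define P where "P \<longleftrightarrow> xs \<noteq> [] \<and> C v (x # xs) 0 \<noteq> C v (x # xs) 1"
  \<comment> \<open>A change occurs either at the end of the first edge, which is \<open>P\<close>,
    or within the remaining walk, with its index shifted by one.\<close>
  have "card (D v (x # xs)) \<le> of_bool (P) + card (D (v \<oplus> {x}) xs)"
  proof -
    have "D v (x # xs) \<subseteq> (if P then {1} else {}) \<union> Suc ` D (v \<oplus> {x}) xs"
    proof
      fix k assume k: "k \<in> D v (x # xs)"
      then obtain j where j: "k = Suc j" by (cases k) (auto simp: D_def)
      show "k \<in> (if P then {1} else {}) \<union> Suc ` D (v \<oplus> {x}) xs"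
      proof (cases j)
        case 0
        then show ?thesis using k j by (auto simp: D_def P_def)
      next
        case (Suc i)
        then have "j \<in> D (v \<oplus> {x}) xs"
          using k C_Suc[of i] C_Suc[of j] unfolding j D_def by simp
        then show ?thesis using j by blast
      qed
    qed
    moreover have fin: "finite (D w ys)" for w ys by (rule finite_subset[of _ "{..<length ys}"]) (auto simp: D_def)
    ultimately have "card (D v (x # xs)) \<le> card ((if P then {1} else {}) \<union> Suc ` D (v \<oplus> {x}) xs)"
      by (intro card_mono) auto
    also have "\<dots> \<le> card (if P then {1::nat} else {}) + card (Suc ` D (v \<oplus> {x}) xs)"
      by (rule card_Un_le)
    finally show ?thesis by (simp add: card_image split: if_splits)
  qed
  also have "\<dots> \<le> cost (v \<oplus> {x}) (col v x) xs b"
  proof (cases xs)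
    case (Cons y ys)
    have "C v (x # xs) 0 = col v x" by (simp add: C_def)
    moreover have "C v (x # xs) 1 = col (v \<oplus> {x}) y" using C_Suc[of 0] Cons by (simp add: C_def)
    moreover have "cost (v \<oplus> {x}) (col v x) xs b = of_bool (col v x \<noteq> col (v \<oplus> {x}) y) + cost (v \<oplus> {x}) (col (v \<oplus> {x}) y) xs b"
      using Cons by simp
    moreover have "xs \<noteq> []" using Cons by simp
    ultimately show ?thesis using IH[of "col (v \<oplus> {x}) y"] by (simp add: P_def)
  qed (simp add: D_def P_def)
  finally show ?case unfolding D_def C_def by simp
qed simp

end

theorem theorem2:
  fixes n :: nat and c :: "bool list set \<Rightarrow> bool"
  assumes "n \<ge> 2"
  shows "\<exists>p. antipodal_geodesic n p \<and> real (color_changes c p) \<le> 0.3125 * real n + 6"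
proof -
  \<comment> \<open>Edges are unordered pairs, so both ends of an edge see the same colour, as the
    locale requires.\<close>
  define col where "col v i = c {to_list n v, to_list n (v \<oplus> {i})}" for v i
  interpret cube_colouring col
    by unfold_locales (simp add: col_def insert_commute)
  obtain v a b k where v: "v \<subseteq> {..<n}" and "walk v {..<n} a b k" and k: "real k \<le> 5 / 16 * real n + 6"
    using ex_walk by blast
  then obtain xs where xs: "distinct xs" "set xs = {..<n}" and cost: "cost v a xs b \<le> k"
    unfolding walk_def by blast
  have len: "length xs = n" using distinct_card[OF xs(1)] xs(2) by simp
  define w where "w j = v \<oplus> set (take j xs)" for j
  define p where "p = map (\<lambda>j. to_list n (w j)) [0..<n + 1]"
  have p_nth: "p ! j = to_list n (w j)" if "j \<le> n" for j
    unfolding p_def using that by (subst nth_map) (auto simp del: upt_Suc)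
  have len_p: "length p = n + 1" by (simp add: p_def)
  have w_Suc: "w (Suc j) = w j \<oplus> {xs ! j}" if "j < n" for j
  proof -
    have "take (Suc j) xs = take j xs @ [xs ! j]" using that len by (simp add: take_Suc_conv_app_nth)
    moreover have "distinct (take (Suc j) xs)" using xs(1) by (rule distinct_take)
    ultimately have "set (take (Suc j) xs) = set (take j xs) \<union> {xs ! j}" "set (take j xs) \<inter> {xs ! j} = {}"
      by auto
    then show ?thesis unfolding w_def by (simp only: flip_Un)
  qed
  have xs_less: "xs ! j < n" if "j < n" for j
    using nth_mem[of j xs] that len xs(2) by auto
  have edge: "{p ! j, p ! Suc j} \<in> cube_edges n" "c {p ! j, p ! Suc j} = col (w j) (xs ! j)" if "j < n" for j
    using that cube_edge[OF xs_less[OF that], of "w j"] by (simp_all add: p_nth w_Suc col_def)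
  have "inj_on (\<lambda>j. to_list n (w j)) {0..<n + 1}"
  proof (rule inj_onI)
    fix i j assume ij: "i \<in> {0..<n + 1}" "j \<in> {0..<n + 1}" and eq: "to_list n (w i) = to_list n (w j)"
    have sub: "set (take l xs) \<subseteq> {..<n}" for l using xs(2) set_take_subset[of l xs] by simp
    have "x \<in> set (take i xs) \<longleftrightarrow> x \<in> set (take j xs)" for x
    proof (cases "x < n")
      case True
      from to_list_eqD[OF eq this] show ?thesis by (auto simp: w_def flip_def)
    next
      case False
      then show ?thesis using sub[of i] sub[of j] by auto
    qed
    then have "set (take i xs) = set (take j xs)" by blast
    \<comment> \<open>As \<open>xs\<close> is distinct, these cardinalities are \<open>i\<close> and
      \<open>j\<close>.\<close>
    then have "card (set (take i xs)) = card (set (take j xs))" by simp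
    then show "i = j"
      using ij by (simp add: distinct_card distinct_take xs(1) len)
  qed
  then have "distinct p" unfolding p_def by (simp add: distinct_map del: upt_Suc)
  moreover have "set p \<subseteq> cube_vertices n" by (auto simp: p_def cube_vertices_def)
  moreover have "p \<noteq> []" using len_p by auto
  ultimately have "cube_path n p"
    unfolding cube_path_def using edge(1) len_p by simp
  moreover have "last p = antipode (hd p)"
  proof -
    have "last p = to_list n (w n)" "hd p = to_list n (w 0)"
      using p_nth[of n] p_nth[of 0] \<open>p \<noteq> []\<close> len_p by (simp_all add: last_conv_nth hd_conv_nth)
    moreover have "w n = v \<oplus> {..<n}" "w 0 = v" by (simp_all add: w_def len xs(2))
    ultimately show ?thesis by (auto simp: antipode_def to_list_def flip_def)
  qed
  ultimately have "antipodal_geodesic n p" using len_p by (simp add: antipodal_geodesic_def)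
  moreover have "color_changes c p \<le> cost v a xs b"
  proof -
    have "{i. 0 < i \<and> Suc i < length p \<and> c {p ! (i - 1), p ! i} \<noteq> c {p ! i, p ! Suc i}}
      = {k. 0 < k \<and> k < length xs \<and> col (w (k - 1)) (xs ! (k - 1)) \<noteq> col (w k) (xs ! k)}"
    proof (rule Collect_cong)
      fix i
      show "0 < i \<and> Suc i < length p \<and> c {p ! (i - 1), p ! i} \<noteq> c {p ! i, p ! Suc i} \<longleftrightarrow>
        0 < i \<and> i < length xs \<and> col (w (i - 1)) (xs ! (i - 1)) \<noteq> col (w i) (xs ! i)"
        using edge(2)[of "i - 1"] edge(2)[of i] by (cases i) (auto simp: len len_p)
    qed
    then show ?thesis
      using changes_le_cost[OF xs(1), of v a b] unfolding color_changes_def w_def by simp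
  qed
  ultimately show ?thesis using cost k by (intro exI[of _ p]) auto
qed

end
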